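(* Let $$M=\frac{\sqrt{2}(3+\sqrt{3})}{8}\quad\text{and}\quad \lambda=\sqrt 2\,(1-\sqrt M).$$ For any $\tilde\lambda<\lambda$ and any $t_0>0$, there exists a constant $C$ such that, for any probability measures $\nu$ and $\tilde\nu$ on $[0,\infty)$ and any $t\geq t_0$, $$\|\nu P_t-\tilde\nu P_t\|_{\mathrm{TV}}\leq C\exp\left(-\frac{2\tilde\lambda}{3}\,t\right),$$ where $(P_t)_{t\ge 0}$ is the semigroup of the TCP window size process.
   Context: The TCP window size process $X=(X_t)_{t\ge 0}$ is the continuous-time Markov process on $[0,\infty)$ with infinitesimal generator $Lf(x)=f'(x)+x\,(f(x/2)-f(x))$ for smooth $f$. That is, between jumps $X$ increases linearly with slope $1$; jumps occur at rate $X_t$ (so, starting from $x$, the first jump time $T_1$ satisfies $\mathbb P_x(T_1>t)=e^{-t^2/2-xt}$); and at a jump the current position is divided by $2$. Its semigroup is $P_tf(x)=\mathbb E(f(X_t)\mid X_0=x)$, and for a probability measure $\nu$ on $[0,\infty)$, $\nu P_t$ denotes the law of $X_t$ when $X_0$ has law $\nu$. A coupling of two probability measures $\nu,\tilde\nu$ on $\mathbb R$ is a probability measure on $\mathbb R\times\mathbb R$ with marginals $\nu$ and $\tilde\nu$; $\Gamma(\nu,\tilde\nu)$ is the set of all couplings. The total variation distance is normalized as $\|\nu-\tilde\nu\|_{\mathrm{TV}}=\inf_{\Pi\in\Gamma(\nu,\tilde\nu)}\int_{\mathbb R^2}\mathbf 1_{\{x\neq y\}}\,\Pi(dx,dy)$.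 *)

theory Defs
  imports "HOL-Probability.Probability"
begin

text \<open>
  The process is built from its jump description, driven by i.i.d. standard exponential
  clocks \<open>\<omega> 0, \<omega> 1, \<dots>\<close>.  Started at \<open>x \<ge> 0\<close>, the jump rate at time \<open>s\<close> before the first
  jump is \<open>x + s\<close>, so the first jump time is the solution \<open>t\<close> of
  \<open>t\<^sup>2 / 2 + x * t = e\<close>, where \<open>e\<close> is the clock.
\<close>

definition tcp_wait :: "real \<Rightarrow> real \<Rightarrow> real" where
  "tcp_wait x e = sqrt (x\<^sup>2 + 2 * e) - x"

definition tcp_clocks :: "(nat \<Rightarrow> real) measure" where
  "tcp_clocks = (\<Pi>\<^sub>M n\<in>UNIV. density lborel (\<lambda>e. ennreal (exponential_density 1 e)))"

text \<open>Position immediately after the \<open>n\<close>-th jump (\<open>n = 0\<close>: the initial position).\<close>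

primrec tcp_pos :: "real \<Rightarrow> (nat \<Rightarrow> real) \<Rightarrow> nat \<Rightarrow> real" where
  "tcp_pos x \<omega> 0 = x"
| "tcp_pos x \<omega> (Suc n) = (tcp_pos x \<omega> n + tcp_wait (tcp_pos x \<omega> n) (\<omega> n)) / 2"

text \<open>Time of the \<open>n\<close>-th jump (\<open>n = 0\<close>: time \<open>0\<close>).\<close>

definition tcp_time :: "real \<Rightarrow> (nat \<Rightarrow> real) \<Rightarrow> nat \<Rightarrow> real" where
  "tcp_time x \<omega> n = (\<Sum>k<n. tcp_wait (tcp_pos x \<omega> k) (\<omega> k))"

text \<open>Number of jumps up to and including time \<open>t\<close>; almost surely finite.\<close>

definition tcp_count :: "real \<Rightarrow> (nat \<Rightarrow> real) \<Rightarrow> real \<Rightarrow> nat" where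
  "tcp_count x \<omega> t = card {n. tcp_time x \<omega> (Suc n) \<le> t}"

definition tcp_process :: "real \<Rightarrow> (nat \<Rightarrow> real) \<Rightarrow> real \<Rightarrow> real" where
  "tcp_process x \<omega> t =
     tcp_pos x \<omega> (tcp_count x \<omega> t) + (t - tcp_time x \<omega> (tcp_count x \<omega> t))"

text \<open>The transition kernel \<open>P\<^sub>t(x, \<cdot>)\<close>: the law of \<open>X\<^sub>t\<close> given \<open>X\<^sub>0 = x\<close>.\<close>

definition tcp_kernel :: "real \<Rightarrow> real \<Rightarrow> real measure" where
  "tcp_kernel t x = distr tcp_clocks borel (\<lambda>\<omega>. tcp_process x \<omega> t)"

text \<open>
  The law \<open>\<nu> P\<^sub>t\<close> of \<open>X\<^sub>t\<close> when \<open>X\<^sub>0\<close> has law \<open>\<nu>\<close> (and is independent of the clocks);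
  \<open>tcp_law_eq_bind\<close> below is the kernel form.
\<close>

definition tcp_law :: "real measure \<Rightarrow> real \<Rightarrow> real measure" where
  "tcp_law \<nu> t = distr (\<nu> \<Otimes>\<^sub>M tcp_clocks) borel (\<lambda>(x, \<omega>). tcp_process x \<omega> t)"

text \<open>Probability measures on \<open>[0, \<infinity>)\<close> are Borel probability measures on the line carried by \<open>[0, \<infinity>)\<close>.\<close>

definition prob_on_nonneg :: "real measure \<Rightarrow> bool" where
  "prob_on_nonneg \<nu> \<longleftrightarrow> sets \<nu> = sets borel \<and> prob_space \<nu> \<and> (AE x in \<nu>. 0 \<le> x)"

definition couplings :: "real measure \<Rightarrow> real measure \<Rightarrow> (real \<times> real) measure set" where
  "couplings \<mu> \<nu> = {\<gamma>. sets \<gamma> = sets (borel \<Otimes>\<^sub>M borel) \<and> prob_space \<gamma> \<and>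
     distr \<gamma> borel fst = \<mu> \<and> distr \<gamma> borel snd = \<nu>}"

definition tv_dist :: "real measure \<Rightarrow> real measure \<Rightarrow> real" where
  "tv_dist \<mu> \<nu> = (INF \<gamma>\<in>couplings \<mu> \<nu>. \<integral>p. indicator {(x, y). x \<noteq> y} p \<partial>\<gamma>)"

definition tcp_M :: real where
  "tcp_M = sqrt 2 * (3 + sqrt 3) / 8"

definition tcp_lambda :: real where
  "tcp_lambda = sqrt 2 * (1 - sqrt tcp_M)"


subsection \<open>Consistency of the construction\<close>

lemma sets_tcp_clocks [measurable_cong]: "sets tcp_clocks = sets (\<Pi>\<^sub>M n\<in>(UNIV::nat set). borel)"
  unfolding tcp_clocks_def by (intro sets_PiM_cong) auto

lemma prob_space_exponential: "prob_space (density lborel (\<lambda>e. ennreal (exponential_density 1 e)))"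
  by (rule prob_space_exponential_density) simp

lemma prob_space_tcp_clocks: "prob_space tcp_clocks"
  unfolding tcp_clocks_def by (intro prob_space_PiM prob_space_exponential)

lemma measurable_tcp_wait [measurable]: "(\<lambda>(x, e). tcp_wait x e) \<in> borel_measurable borel"
  unfolding tcp_wait_def borel_prod[symmetric] by measurable

lemma measurable_tcp_pos [measurable]:
  "(\<lambda>(x, \<omega>). tcp_pos x \<omega> n) \<in> borel_measurable (borel \<Otimes>\<^sub>M tcp_clocks)"
proof (induction n)
  case (Suc n)
  note Suc [measurable]
  show ?case unfolding tcp_pos.simps tcp_wait_def by measurable
qed simp

lemma measurable_tcp_time [measurable]:
  "(\<lambda>(x, \<omega>). tcp_time x \<omega> n) \<in> borel_measurable (borel \<Otimes>\<^sub>M tcp_clocks)"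
  unfolding tcp_time_def tcp_wait_def by measurable

lemma measurable_tcp_count [measurable]:
  "(\<lambda>(x, \<omega>). tcp_count x \<omega> t) \<in> measurable (borel \<Otimes>\<^sub>M tcp_clocks) (count_space UNIV)"
  unfolding tcp_count_def by measurable

lemma measurable_tcp_process [measurable]:
  "(\<lambda>(x, \<omega>). tcp_process x \<omega> t) \<in> borel_measurable (borel \<Otimes>\<^sub>M tcp_clocks)"
  unfolding tcp_process_def by measurable

lemma tcp_wait_solves:
  assumes "0 \<le> x" "0 \<le> e"
  shows "0 \<le> tcp_wait x e" "(tcp_wait x e)\<^sup>2 / 2 + x * tcp_wait x e = e"
proof -
  show "0 \<le> tcp_wait x e"
    using assms by (simp add: tcp_wait_def real_le_rsqrt)
  have "(sqrt (x\<^sup>2 + 2 * e))\<^sup>2 = x\<^sup>2 + 2 * e" using assms by simp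
  then show "(tcp_wait x e)\<^sup>2 / 2 + x * tcp_wait x e = e"
    by (simp add: tcp_wait_def power2_eq_square field_simps)
qed

lemma tcp_first_jump_tail:
  assumes "0 \<le> x" "0 \<le> t"
  shows "measure tcp_clocks {\<omega> \<in> space tcp_clocks. t < tcp_time x \<omega> 1} = exp (- t\<^sup>2 / 2 - x * t)"
proof -
  interpret E: prob_space "density lborel (\<lambda>e. ennreal (exponential_density 1 e))"
    by (rule prob_space_exponential)
  interpret P: product_prob_space "\<lambda>_. density lborel (\<lambda>e. ennreal (exponential_density 1 e))"
      "UNIV :: nat set" ..
  have lt: "t < tcp_wait x e \<longleftrightarrow> t\<^sup>2 / 2 + x * t < e" for e
  proof -
    have "t < tcp_wait x e \<longleftrightarrow> x + t < sqrt (x\<^sup>2 + 2 * e)" by (auto simp: tcp_wait_def)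
    also have "\<dots> \<longleftrightarrow> sqrt ((x + t)\<^sup>2) < sqrt (x\<^sup>2 + 2 * e)" using assms by simp
    also have "\<dots> \<longleftrightarrow> t\<^sup>2 / 2 + x * t < e"
      unfolding real_sqrt_less_iff by (simp add: power2_eq_square field_simps)
    finally show ?thesis .
  qed
  let ?X = "{e. t\<^sup>2 / 2 + x * t < e}"
  have comp: "distr tcp_clocks (density lborel (\<lambda>e. ennreal (exponential_density 1 e))) (\<lambda>\<omega>. \<omega> 0)
      = density lborel (\<lambda>e. ennreal (exponential_density 1 e))"
    unfolding tcp_clocks_def by (rule P.PiM_component) simp
  have "measure tcp_clocks {\<omega> \<in> space tcp_clocks. t < tcp_time x \<omega> 1}
      = measure tcp_clocks ((\<lambda>\<omega>. \<omega> 0) -` ?X \<inter> space tcp_clocks)"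
    by (intro arg_cong[where f = "measure tcp_clocks"]) (auto simp: tcp_time_def lt)
  also have "\<dots> = measure (distr tcp_clocks
      (density lborel (\<lambda>e. ennreal (exponential_density 1 e))) (\<lambda>\<omega>. \<omega> 0)) ?X"
    by (rule measure_distr[symmetric]) (simp_all add: tcp_clocks_def measurable_component_singleton)
  also have "\<dots> = measure (density lborel (\<lambda>e. ennreal (exponential_density 1 e))) ?X"
    by (simp only: comp)
  also have "\<dots> = exp (- t\<^sup>2 / 2 - x * t)"
  proof -
    have "E.prob {e \<in> space (density lborel (\<lambda>e. ennreal (exponential_density 1 e))).
        t\<^sup>2 / 2 + x * t < e} = exp (- (t\<^sup>2 / 2 + x * t) * 1)"
      by (rule E.exponential_distributedD_gt[where X = "\<lambda>e. e"])
        (use assms in \<open>auto simp: distributed_def distr_id2\<close>)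
    then show ?thesis by simp
  qed
  finally show ?thesis .
qed

lemma prob_space_tcp_law:
  assumes "prob_on_nonneg \<nu>"
  shows "prob_space (tcp_law \<nu> t)"
proof -
  interpret N: prob_space \<nu> using assms by (simp add: prob_on_nonneg_def)
  interpret C: prob_space tcp_clocks by (rule prob_space_tcp_clocks)
  interpret pair_prob_space \<nu> tcp_clocks ..
  have [measurable_cong]: "sets \<nu> = sets borel" using assms by (simp add: prob_on_nonneg_def)
  show ?thesis unfolding tcp_law_def by (intro prob_space_distr) measurable
qed

lemma tcp_law_eq_bind:
  assumes "prob_on_nonneg \<nu>"
  shows "tcp_law \<nu> t = \<nu> \<bind> tcp_kernel t"
proof -
  interpret N: prob_space \<nu> using assms by (simp add: prob_on_nonneg_def)
  interpret C: prob_space tcp_clocks by (rule prob_space_tcp_clocks)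
  interpret pair_prob_space \<nu> tcp_clocks ..
  have s [measurable_cong]: "sets \<nu> = sets borel" using assms by (simp add: prob_on_nonneg_def)
  have c: "tcp_clocks \<in> space (subprob_algebra tcp_clocks)"
    using C.subprob_space_axioms by (simp add: space_subprob_algebra)
  have k: "tcp_kernel t \<in> measurable \<nu> (subprob_algebra borel)"
    unfolding tcp_kernel_def
    by (rule measurable_distr2[where M = tcp_clocks]) (use c in \<open>simp_all\<close>)
  show ?thesis
  proof (rule measure_eqI)
    show "sets (tcp_law \<nu> t) = sets (\<nu> \<bind> tcp_kernel t)"
      using sets_bind[OF sets_kernel[OF k], of \<nu>] N.not_empty by (simp add: tcp_law_def)
    fix A assume "A \<in> sets (tcp_law \<nu> t)"
    then have A [measurable]: "A \<in> sets borel" by (simp add: tcp_law_def)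
    have "emeasure (tcp_law \<nu> t) A
        = (\<integral>\<^sup>+x. \<integral>\<^sup>+\<omega>. indicator A (tcp_process x \<omega> t) \<partial>tcp_clocks \<partial>\<nu>)"
      unfolding tcp_law_def
      by (subst nn_integral_indicator[symmetric], simp, subst nn_integral_distr)
        (auto simp: C.nn_integral_fst[symmetric] split_beta')
    also have "\<dots> = (\<integral>\<^sup>+x. emeasure (tcp_kernel t x) A \<partial>\<nu>)"
      unfolding tcp_kernel_def
      by (intro nn_integral_cong, subst nn_integral_indicator[symmetric], simp,
          subst nn_integral_distr) auto
    also have "\<dots> = emeasure (\<nu> \<bind> tcp_kernel t) A"
      by (rule emeasure_bind[symmetric, OF N.not_empty k]) simp
    finally show "emeasure (tcp_law \<nu> t) A = emeasure (\<nu> \<bind> tcp_kernel t) A" .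
  qed
qed

end

theory Submission
  imports Defs
begin

text \<open>
  Off the event of having no jump during a final time span \<open>\<tau>\<close>, whose probability is at most
  \<open>exp (- \<tau>\<^sup>2 / 2)\<close>, the law at the end depends on the starting point in a Lipschitz way, because
  trajectories from nearby points can be made to coincide after one jump.  It therefore suffices to
  contract a distance of the form \<open>sqrt \<bar>x - y\<bar>\<close> beforehand.  Under the coupling with as many
  simultaneous jumps as possible the square root of the distance decreases at a rate proportional to
  the larger position; a weight that decreases with the larger position turns this into a constant
  rate.  This is an elementary one-step estimate for the Euler scheme
  \<open>Q\<^sub>h f x = (1 - x h) f (x + h) + x h f (x / 2 + h)\<close>, and it passes to the limit \<open>P\<^sub>t\<close>.
  The process comes down from infinity, so that its mean at time 1 is bounded uniformly in the starting
  point.  Truncating at a level \<open>R\<close> costs \<open>3 / R\<close> and a Lipschitz constant of order \<open>R\<close>, hence a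
  factor \<open>sqrt R\<close>; balancing the two reduces the contraction rate by the factor \<open>2 / 3\<close>.
  The weight chosen here yields the rate \<open>3 / 20 > tcp_lambda\<close>, which leaves enough room to take
  \<open>\<tau>\<close> proportional to \<open>t\<close>.
\<close>

text \<open>The jump rate is unbounded, so no estimate of the scheme is uniform on the half-line.
  The remedy is that a path from \<open>x\<close> stays in \<open>[0, x + t]\<close> up to time
  \<open>t\<close>: all error bounds are local, on \<open>x + t \<le> K\<close> with
  \<open>K * h \<le> 1\<close>, and \<open>K\<close> is gone from the contraction bound that
  survives the limit. No continuous-time coupling is built. The work is done on test functions:
  \<open>tcp_op\<close> is determined by its renewal equation at the first jump, and the coupling
  survives only as a splitting of \<open>euler h f x - euler h f y\<close> into three terms. The
  square root is forced. Let positions \<open>x\<close> and \<open>x + d\<close> jump together at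
  rate \<open>x\<close>, and the larger one alone at rate \<open>d\<close>. For the plain distance
  the joint jumps gain \<open>x * d / 2\<close>, but the lone jumps open a gap near
  \<open>x / 2\<close> at rate \<open>d\<close>, which cancels the gain to first order in
  \<open>d\<close>. For the square root the joint gain is of order \<open>x * sqrt d\<close> and the
  lone loss only of order \<open>d * sqrt x\<close>.\<close>

abbreviation clock :: "real measure" where
  "clock \<equiv> density lborel (\<lambda>e. ennreal (exponential_density 1 e))"

text \<open>The jump rate integrated along the flow from \<open>x\<close>. Its inverse in
  \<open>t\<close> is \<open>tcp_wait x\<close>, and \<open>exp (- hazard x t)\<close> is the
  probability of no jump up to \<open>t\<close>.\<close>

definition hazard :: "real \<Rightarrow> real \<Rightarrow> real" where
  "hazard x t = x * t + t\<^sup>2 / 2"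

text \<open>The density of the first jump time: the derivative of
  \<open>1 - exp (- hazard x w)\<close> in \<open>w\<close>.\<close>

definition jump_density :: "real \<Rightarrow> real \<Rightarrow> real" where
  "jump_density x w = (x + w) * exp (- hazard x w)"

definition tcp_op :: "real \<Rightarrow> (real \<Rightarrow> real) \<Rightarrow> real \<Rightarrow> real" where
  "tcp_op t f x = (\<integral>\<omega>. f (tcp_process x \<omega> t) \<partial>tcp_clocks)"

text \<open>The set counted by \<open>tcp_count\<close>. It is kept as a set because
  \<open>card\<close> is \<open>0\<close> on infinite sets, so finiteness has to be settled before
  the count means anything.\<close>

definition jumps_upto :: "real \<Rightarrow> (nat \<Rightarrow> real) \<Rightarrow> real \<Rightarrow> nat set" where
  "jumps_upto x \<omega> t = {n. tcp_time x \<omega> (Suc n) \<le> t}"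

interpretation clock: prob_space clock
  by (rule prob_space_exponential)

interpretation clocks: prob_space tcp_clocks
  by (rule prob_space_tcp_clocks)

interpretation clock_seq: sequence_space clock ..

lemma space_tcp_clocks [simp]: "space tcp_clocks = UNIV"
  by (simp add: tcp_clocks_def space_PiM)

text \<open>Prepending an independent clock preserves the law of the sequence; with the restart
  lemmas below this is the Markov property at the first jump.\<close>

lemma tcp_clocks_iter: "distr (clock \<Otimes>\<^sub>M tcp_clocks) tcp_clocks (\<lambda>(s, \<omega>). case_nat s \<omega>) = tcp_clocks"
  unfolding tcp_clocks_def by (rule clock_seq.PiM_iter)

lemma measurable_case_nat_clocks [measurable]:
  "(\<lambda>(s, \<omega>). case_nat s \<omega>) \<in> measurable (borel \<Otimes>\<^sub>M tcp_clocks) tcp_clocks"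
  unfolding tcp_clocks_def by (rule measurable_PiM_single') (auto simp: split_beta' split: nat.split)

subsection \<open>The process after its first jump\<close>

lemma tcp_pos_case_nat:
  "tcp_pos x (case_nat e \<omega>) (Suc n) = tcp_pos ((x + tcp_wait x e) / 2) \<omega> n"
  by (induction n) simp_all

lemma tcp_time_case_nat:
  "tcp_time x (case_nat e \<omega>) (Suc n) = tcp_wait x e + tcp_time ((x + tcp_wait x e) / 2) \<omega> n"
  unfolding tcp_time_def sum.lessThan_Suc_shift by (simp only: tcp_pos_case_nat) simp

lemma tcp_pos_nonneg:
  assumes "0 \<le> x" "\<And>i. 0 \<le> \<omega> i"
  shows "0 \<le> tcp_pos x \<omega> n"
  by (induction n) (use assms in \<open>auto intro!: divide_nonneg_nonneg add_nonneg_nonneg tcp_wait_solves\<close>)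

lemma tcp_time_nonneg:
  assumes "0 \<le> x" "\<And>i. 0 \<le> \<omega> i"
  shows "0 \<le> tcp_time x \<omega> n"
  unfolding tcp_time_def by (intro sum_nonneg tcp_wait_solves tcp_pos_nonneg assms)

text \<open>With nonnegative clocks all later jump times are at least \<open>w\<close>, so a first
  jump after \<open>t\<close> leaves no index at all; otherwise indices shift by one.\<close>

lemma jumps_upto_case_nat:
  assumes "0 \<le> x" "0 \<le> e" "\<And>i. 0 \<le> \<omega> i"
  defines "w \<equiv> tcp_wait x e"
  shows "jumps_upto x (case_nat e \<omega>) t =
    (if w \<le> t then insert 0 (Suc ` jumps_upto ((x + w) / 2) \<omega> (t - w)) else {})"
proof -
  have x': "0 \<le> (x + w) / 2" using assms(1,2) by (simp add: w_def tcp_wait_solves)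
  have ge: "0 \<le> tcp_time ((x + w) / 2) \<omega> n" for n
    by (rule tcp_time_nonneg[OF x' assms(3)])
  have time: "tcp_time x (case_nat e \<omega>) (Suc n) = w + tcp_time ((x + w) / 2) \<omega> n" for n
    unfolding w_def by (rule tcp_time_case_nat)
  have "n \<in> jumps_upto x (case_nat e \<omega>) t \<longleftrightarrow>
      w \<le> t \<and> (n = 0 \<or> n \<in> Suc ` jumps_upto ((x + w) / 2) \<omega> (t - w))" for n
  proof (cases n)
    case 0
    then show ?thesis by (simp add: jumps_upto_def time) (simp add: tcp_time_def)
  next
    case (Suc m)
    then show ?thesis using ge[of "Suc m"] by (auto simp: jumps_upto_def time)
  qed
  then show ?thesis by auto
qed

text \<open>Finiteness makes the count increase by exactly one; for infinitely many jumps both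
  cardinalities would be \<open>0\<close>.\<close>

lemma tcp_process_case_nat:
  assumes "0 \<le> x" "0 \<le> e" "\<And>i. 0 \<le> \<omega> i"
  defines "w \<equiv> tcp_wait x e"
  assumes fin: "finite (jumps_upto ((x + w) / 2) \<omega> (t - w))"
  shows "tcp_process x (case_nat e \<omega>) t =
    (if w \<le> t then tcp_process ((x + w) / 2) \<omega> (t - w) else x + t)"
proof -
  have count: "tcp_count y \<omega>' s = card (jumps_upto y \<omega>' s)" for y \<omega>' s
    by (simp add: tcp_count_def jumps_upto_def)
  show ?thesis
  proof (cases "w \<le> t")
    case True
    have "tcp_count x (case_nat e \<omega>) t = Suc (tcp_count ((x + w) / 2) \<omega> (t - w))"
      unfolding count jumps_upto_case_nat[OF assms(1-3)] using fin True
      by (simp add: w_def card_image image_iff)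
    then show ?thesis
      using True by (simp only: tcp_process_def tcp_pos_case_nat tcp_time_case_nat)
        (simp add: w_def)
  next
    case False
    then have "tcp_count x (case_nat e \<omega>) t = 0"
      unfolding count jumps_upto_case_nat[OF assms(1-3)] by (simp add: w_def)
    then show ?thesis using False by (simp add: tcp_process_def tcp_time_def)
  qed
qed

lemma AE_clocks_nonneg: "AE \<omega> in tcp_clocks. \<forall>i. 0 \<le> \<omega> i"
proof -
  have "AE e in clock. 0 \<le> e"
    by (subst AE_density) (auto simp: exponential_density_def)
  then have "AE \<omega> in tcp_clocks. 0 \<le> \<omega> i" for i
    unfolding tcp_clocks_def by (intro clock_seq.AE_component) auto
  then show ?thesis by (simp add: AE_all_countable)
qed

lemma integral_clock:
  fixes f :: "real \<Rightarrow> real"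
  assumes [measurable]: "f \<in> borel_measurable borel"
  shows "(\<integral>e. f e \<partial>clock) = (\<integral>e. indicator {0..} e * exp (- e) * f e \<partial>lborel)"
  by (subst integral_real_density)
    (auto intro!: Bochner_Integration.integral_cong simp: exponential_density_def indicator_def)

lemma integral_clocks_iter:
  fixes F :: "(nat \<Rightarrow> real) \<Rightarrow> real"
  assumes F [measurable]: "F \<in> borel_measurable tcp_clocks" and bd: "\<And>\<omega>. \<bar>F \<omega>\<bar> \<le> B"
  shows "(\<integral>\<omega>. F \<omega> \<partial>tcp_clocks) = (\<integral>e. (\<integral>\<omega>. F (case_nat e \<omega>) \<partial>tcp_clocks) \<partial>clock)"
proof -
  interpret P: pair_prob_space clock tcp_clocks ..
  have [measurable]: "(\<lambda>(s, \<omega>). case_nat s \<omega>) \<in> measurable (clock \<Otimes>\<^sub>M tcp_clocks) tcp_clocks"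
    using measurable_case_nat_clocks by (simp cong: measurable_cong_sets)
  have "(\<integral>\<omega>. F \<omega> \<partial>tcp_clocks)
      = (\<integral>\<omega>. F \<omega> \<partial>distr (clock \<Otimes>\<^sub>M tcp_clocks) tcp_clocks (\<lambda>(s, \<omega>). case_nat s \<omega>))"
    by (simp only: tcp_clocks_iter)
  also have "\<dots> = (\<integral>p. F (case p of (s, \<omega>) \<Rightarrow> case_nat s \<omega>) \<partial>(clock \<Otimes>\<^sub>M tcp_clocks))"
    by (rule integral_distr) measurable
  also have "\<dots> = (\<integral>e. (\<integral>\<omega>. F (case_nat e \<omega>) \<partial>tcp_clocks) \<partial>clock)"
    by (subst P.integral_fst'[symmetric])
      (auto intro!: P.P.integrable_const_bound[where B = B] bd simp: split_beta')
  finally show ?thesis .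
qed

subsection \<open>Conditioning on the first jump\<close>

text \<open>A nonintegrable function has integral \<open>0\<close>, which also lies within
  \<open>B\<close>; bounds on \<open>tcp_op\<close> therefore carry no integrability side
  condition.\<close>

lemma (in prob_space) abs_expectation_le:
  fixes f :: "'a \<Rightarrow> real"
  assumes "\<And>x. \<bar>f x\<bar> \<le> B"
  shows "\<bar>\<integral>x. f x \<partial>M\<bar> \<le> B"
proof (cases "integrable M f")
  case True
  have le: "f x \<le> B" "- B \<le> f x" for x using assms[of x] by linarith+
  show ?thesis
    using integral_le_const[OF True, of B] integral_ge_const[OF True, of "- B"] le by auto
next
  case False
  then show ?thesis using order_trans[OF abs_ge_zero assms] by (simp add: not_integrable_integral_eq)
qed

text \<open>Expectation of \<open>G\<close> at the first jump time, on the event that this jump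
  occurs by time \<open>t\<close>. For \<open>x\<close> and \<open>t\<close> nonnegative it is a
  positive operator of mass \<open>1 - exp (- hazard x t)\<close>.\<close>

definition first_jump :: "real \<Rightarrow> real \<Rightarrow> (real \<Rightarrow> real) \<Rightarrow> real" where
  "first_jump x t G = (\<integral>w. indicator {0..t} w * (jump_density x w * G w) \<partial>lborel)"

lemma hazard_nonneg: "0 \<le> x \<Longrightarrow> 0 \<le> t \<Longrightarrow> 0 \<le> hazard x t"
  by (simp add: hazard_def)

lemma hazard_0 [simp]: "hazard x 0 = 0"
  by (simp add: hazard_def)

lemma tcp_wait_hazard:
  assumes "0 \<le> x" "0 \<le> w"
  shows "tcp_wait x (hazard x w) = w"
proof -
  have "x\<^sup>2 + 2 * hazard x w = (x + w)\<^sup>2"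
    by (simp add: hazard_def power2_eq_square algebra_simps)
  then show ?thesis using assms by (simp add: tcp_wait_def)
qed

lemma hazard_wait:
  assumes "0 \<le> x" "0 \<le> e"
  shows "hazard x (tcp_wait x e) = e"
  using tcp_wait_solves(2)[OF assms] by (simp add: hazard_def)

lemma hazard_mono: "0 \<le> x \<Longrightarrow> 0 \<le> s \<Longrightarrow> s \<le> t \<Longrightarrow> hazard x s \<le> hazard x t"
  by (auto simp: hazard_def intro!: add_mono mult_left_mono divide_right_mono power_mono)

lemma tcp_wait_le_iff:
  assumes "0 \<le> x" "0 \<le> e" "0 \<le> t"
  shows "tcp_wait x e \<le> t \<longleftrightarrow> e \<le> hazard x t"
proof
  assume "tcp_wait x e \<le> t"
  then show "e \<le> hazard x t"
    using hazard_mono[OF assms(1) tcp_wait_solves(1)[OF assms(1,2)]] hazard_wait[OF assms(1,2)] by simp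
next
  assume "e \<le> hazard x t"
  then have "tcp_wait x e \<le> tcp_wait x (hazard x t)" by (simp add: tcp_wait_def)
  then show "tcp_wait x e \<le> t" using tcp_wait_hazard assms by simp
qed

lemma jump_density_nonneg: "0 \<le> x \<Longrightarrow> 0 \<le> w \<Longrightarrow> 0 \<le> jump_density x w"
  by (simp add: jump_density_def)

lemma continuous_jump_density: "continuous_on S (jump_density x)"
  unfolding jump_density_def hazard_def by (intro continuous_intros) auto

lemma jump_density_measurable [measurable]: "jump_density x \<in> borel_measurable borel"
  unfolding jump_density_def hazard_def by measurable

lemma has_bochner_integral_jump_density:
  assumes "a \<le> b"
  shows "has_bochner_integral lborel (\<lambda>w. jump_density x w * indicator {a..b} w)
    (exp (- hazard x a) - exp (- hazard x b))"
proof -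
  have "has_bochner_integral lborel (\<lambda>w. jump_density x w * indicator {a..b} w)
    (- exp (- hazard x b) - - exp (- hazard x a))"
    using assms
  proof (rule has_bochner_integral_FTC_Icc_real)
    show "((\<lambda>w. - exp (- hazard x w)) has_real_derivative jump_density x w) (at w)" for w
      unfolding jump_density_def hazard_def
      by (auto intro!: derivative_eq_intros simp: algebra_simps)
    show "isCont (jump_density x) w" for w
      using continuous_jump_density[of UNIV x] by (simp add: continuous_on_eq_continuous_at)
  qed
  then show ?thesis by simp
qed

lemma first_jump_integrable:
  assumes [measurable]: "G \<in> borel_measurable borel"
    and "0 \<le> x" and bd: "\<And>w. 0 \<le> w \<Longrightarrow> w \<le> t \<Longrightarrow> \<bar>G w\<bar> \<le> B"
  shows "integrable lborel (\<lambda>w. indicator {0..t} w * (jump_density x w * G w))"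
proof (cases "0 \<le> t")
  case True
  have "integrable lborel (\<lambda>w. B * (jump_density x w * indicator {0..t} w))"
    using has_bochner_integral_jump_density[OF True] by (intro integrable_mult_right) (auto simp: has_bochner_integral_iff)
  then show ?thesis
    by (rule Bochner_Integration.integrable_bound)
      (use assms True in \<open>auto simp: indicator_def abs_mult jump_density_nonneg mult.commute[of "\<bar>B\<bar>"]
        intro!: AE_I2 mult_left_mono order_trans[OF bd]\<close>)
qed simp

lemma first_jump_const:
  assumes "0 \<le> t"
  shows "first_jump x t (\<lambda>_. c) = c * (1 - exp (- hazard x t))"
proof -
  have "first_jump x t (\<lambda>_. c) = (\<integral>w. c * (jump_density x w * indicator {0..t} w) \<partial>lborel)"
    unfolding first_jump_def by (intro Bochner_Integration.integral_cong) auto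
  also have "\<dots> = c * (1 - exp (- hazard x t))"
    using has_bochner_integral_integral_eq[OF has_bochner_integral_jump_density[OF assms, of x]]
    by (subst integral_mult_right_zero) simp
  finally show ?thesis .
qed

lemma first_jump_diff:
  assumes "G \<in> borel_measurable borel" "G' \<in> borel_measurable borel" "0 \<le> x"
    and "\<And>w. 0 \<le> w \<Longrightarrow> w \<le> t \<Longrightarrow> \<bar>G w\<bar> \<le> B" "\<And>w. 0 \<le> w \<Longrightarrow> w \<le> t \<Longrightarrow> \<bar>G' w\<bar> \<le> B'"
  shows "first_jump x t (\<lambda>w. G w - G' w) = first_jump x t G - first_jump x t G'"
  unfolding first_jump_def
  using Bochner_Integration.integral_diff[OF first_jump_integrable[OF assms(1,3,4)]
      first_jump_integrable[OF assms(2,3,5)]]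
  by (simp add: algebra_simps)

lemma first_jump_mono:
  assumes "G \<in> borel_measurable borel" "G' \<in> borel_measurable borel" "0 \<le> x"
    and "\<And>w. 0 \<le> w \<Longrightarrow> w \<le> t \<Longrightarrow> \<bar>G w\<bar> \<le> B" "\<And>w. 0 \<le> w \<Longrightarrow> w \<le> t \<Longrightarrow> \<bar>G' w\<bar> \<le> B'"
    and "\<And>w. 0 \<le> w \<Longrightarrow> w \<le> t \<Longrightarrow> G w \<le> G' w"
  shows "first_jump x t G \<le> first_jump x t G'"
  unfolding first_jump_def
  by (intro integral_mono first_jump_integrable assms)
    (use assms in \<open>auto simp: indicator_def jump_density_nonneg intro!: mult_left_mono\<close>)

lemma first_jump_bound:
  assumes "G \<in> borel_measurable borel" "0 \<le> x" "0 \<le> t"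
    and bd: "\<And>w. 0 \<le> w \<Longrightarrow> w \<le> t \<Longrightarrow> \<bar>G w\<bar> \<le> B"
  shows "\<bar>first_jump x t G\<bar> \<le> B * (1 - exp (- hazard x t))"
proof -
  have "\<bar>G w\<bar> \<le> \<bar>B\<bar>" if "0 \<le> w" "w \<le> t" for w
    using bd[OF that] by linarith
  moreover have "- B \<le> G w" "G w \<le> B" if "0 \<le> w" "w \<le> t" for w
    using bd[OF that] by linarith+
  ultimately have "first_jump x t (\<lambda>_. - B) \<le> first_jump x t G" "first_jump x t G \<le> first_jump x t (\<lambda>_. B)"
    using assms by (auto intro!: first_jump_mono[where B = "\<bar>B\<bar>" and B' = "\<bar>B\<bar>"])
  then show ?thesis using assms(3) by (simp add: first_jump_const)
qed

text \<open>The clock is traded for the jump time by substituting \<open>e = hazard x w\<close>;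
  clocks beyond \<open>hazard x t\<close> contribute the no-jump value \<open>c\<close>.\<close>

lemma integral_clock_first_jump:
  fixes G :: "real \<Rightarrow> real"
  assumes G [measurable]: "G \<in> borel_measurable borel" and "0 \<le> x" "0 \<le> t"
    and bd: "\<And>w. \<bar>G w\<bar> \<le> B"
  shows "(\<integral>e. (if tcp_wait x e \<le> t then G (tcp_wait x e) else c) \<partial>clock)
    = exp (- hazard x t) * c + first_jump x t G"
proof -
  have [measurable]: "tcp_wait x \<in> borel_measurable borel"
    unfolding tcp_wait_def by measurable
  let ?A = "hazard x t"
  let ?H = "\<lambda>e. exp (- e) * (G (tcp_wait x e) - c)"
  have A: "0 \<le> ?A" by (rule hazard_nonneg) fact+
  have B: "0 \<le> B" using order_trans[OF abs_ge_zero bd] .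
  have i0: "integrable clock (\<lambda>e. indicator {0..?A} e * (G (tcp_wait x e) - c))"
    by (rule clock.integrable_const_bound[where B = "B + \<bar>c\<bar>"])
      (auto intro!: AE_I2 order_trans[OF abs_triangle_ineq4] add_mono bd order_trans[OF abs_ge_zero bd]
        simp: indicator_def B)
  \<comment> \<open>Subtracting \<open>c\<close> leaves an integrand supported on a compact
    interval, where the substitution rule applies.\<close>
  have "(\<integral>e. (if tcp_wait x e \<le> t then G (tcp_wait x e) else c) \<partial>clock)
      = (\<integral>e. c + indicator {0..?A} e * (G (tcp_wait x e) - c) \<partial>clock)"
  proof (rule integral_cong_AE)
    have "AE e in clock. 0 \<le> e"
      by (subst AE_density) (auto simp: exponential_density_def)
    then show "AE e in clock. (if tcp_wait x e \<le> t then G (tcp_wait x e) else c)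
        = c + indicator {0..?A} e * (G (tcp_wait x e) - c)"
      by eventually_elim (use tcp_wait_le_iff assms in \<open>auto simp: indicator_def\<close>)
  qed measurable
  also have "\<dots> = c + (\<integral>e. indicator {0..?A} e * (G (tcp_wait x e) - c) \<partial>clock)"
    using i0 by (subst Bochner_Integration.integral_add) (auto simp: clock.prob_space[simplified])
  also have "(\<integral>e. indicator {0..?A} e * (G (tcp_wait x e) - c) \<partial>clock)
      = (\<integral>e. ?H e * indicator {hazard x 0..hazard x t} e \<partial>lborel)"
    by (subst integral_clock) (auto intro!: Bochner_Integration.integral_cong simp: indicator_def)
  also have "\<dots> = (\<integral>w. ?H (hazard x w) * (x + w) * indicator {0..t} w \<partial>lborel)"
  proof (rule integral_substitution(2))
    have "integrable lborel (\<lambda>e. indicator {0..?A} e * (B + \<bar>c\<bar>))"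
      by (intro integrable_mult_left integrable_real_indicator) (auto simp: emeasure_lborel_Icc_eq)
    then show "set_integrable lborel {hazard x 0..hazard x t} ?H"
      unfolding set_integrable_def
    proof (rule Bochner_Integration.integrable_bound)
      have "exp (- e) * \<bar>G (tcp_wait x e) - c\<bar> \<le> 1 * (B + \<bar>c\<bar>)" if "0 \<le> e" for e
        using that bd[of "tcp_wait x e"] by (intro mult_mono) auto
      then show "AE e in lborel. norm (indicator {hazard x 0..hazard x t} e *\<^sub>R ?H e)
          \<le> norm (indicator {0..?A} e * (B + \<bar>c\<bar>))"
        using B by (auto simp: indicator_def abs_mult)
    qed measurable
    show "(hazard x has_real_derivative x + w) (at w)" for w
      unfolding hazard_def by (auto intro!: derivative_eq_intros)
  qed (use assms in \<open>auto intro!: continuous_intros\<close>)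
  also have "\<dots> = first_jump x t (\<lambda>w. G w - c)"
    unfolding first_jump_def
    by (intro Bochner_Integration.integral_cong)
      (use assms in \<open>auto simp: indicator_def tcp_wait_hazard jump_density_def\<close>)
  also have "\<dots> = first_jump x t G - c * (1 - exp (- ?A))"
    using assms by (subst first_jump_diff[where B = B and B' = "\<bar>c\<bar>"]) (auto simp: first_jump_const)
  finally show ?thesis by (simp add: algebra_simps)
qed

text \<open>Kept general because it is used twice: for the indicator of infinitely many jumps, and
  then for \<open>f (tcp_process x \<omega> t)\<close>, whose restart relies on the finiteness
  obtained from the first use.\<close>

lemma expectation_first_jump:
  fixes \<Phi> :: "real \<Rightarrow> real \<Rightarrow> (nat \<Rightarrow> real) \<Rightarrow> real"
  assumes \<Phi> [measurable]: "(\<lambda>(x, t, \<omega>). \<Phi> x t \<omega>) \<in> borel_measurable (borel \<Otimes>\<^sub>M borel \<Otimes>\<^sub>M tcp_clocks)"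
    and bd: "\<And>x t \<omega>. \<bar>\<Phi> x t \<omega>\<bar> \<le> B" and "0 \<le> x" "0 \<le> t"
    and step: "\<And>e. 0 \<le> e \<Longrightarrow> AE \<omega> in tcp_clocks. \<Phi> x t (case_nat e \<omega>) =
      (if tcp_wait x e \<le> t then \<Phi> ((x + tcp_wait x e) / 2) (t - tcp_wait x e) \<omega> else c)"
  shows "(\<integral>\<omega>. \<Phi> x t \<omega> \<partial>tcp_clocks) = exp (- hazard x t) * c +
    first_jump x t (\<lambda>w. \<integral>\<omega>. \<Phi> ((x + w) / 2) (t - w) \<omega> \<partial>tcp_clocks)"
proof -
  have [measurable]: "tcp_wait x \<in> borel_measurable borel"
    unfolding tcp_wait_def by measurable
  have m1: "(\<lambda>(e, \<omega>). \<Phi> ((x + tcp_wait x e) / 2) (t - tcp_wait x e) \<omega>)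
      \<in> borel_measurable (borel \<Otimes>\<^sub>M tcp_clocks)"
    using measurable_compose[OF _ \<Phi>, of "\<lambda>(e, \<omega>). ((x + tcp_wait x e) / 2, t - tcp_wait x e, \<omega>)"
      "borel \<Otimes>\<^sub>M tcp_clocks"] by (simp add: split_beta')
  have m2 [measurable]: "(\<lambda>e. \<integral>\<omega>. \<Phi> ((x + tcp_wait x e) / 2) (t - tcp_wait x e) \<omega> \<partial>tcp_clocks)
      \<in> borel_measurable borel"
    by (rule clocks.borel_measurable_lebesgue_integral[OF m1])
  have "(\<lambda>(w, \<omega>). \<Phi> ((x + w) / 2) (t - w) \<omega>) \<in> borel_measurable (borel \<Otimes>\<^sub>M tcp_clocks)"
    using measurable_compose[OF _ \<Phi>, of "\<lambda>(w, \<omega>). ((x + w) / 2, t - w, \<omega>)"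
      "borel \<Otimes>\<^sub>M tcp_clocks"] by (simp add: split_beta')
  from clocks.borel_measurable_lebesgue_integral[OF this]
  have m3: "(\<lambda>w. \<integral>\<omega>. \<Phi> ((x + w) / 2) (t - w) \<omega> \<partial>tcp_clocks) \<in> borel_measurable borel" .
  have le: "\<bar>\<integral>\<omega>. \<Phi> y s \<omega> \<partial>tcp_clocks\<bar> \<le> B" for y s
    by (rule clocks.abs_expectation_le) (rule bd)
  have "(\<integral>\<omega>. \<Phi> x t \<omega> \<partial>tcp_clocks) = (\<integral>e. (\<integral>\<omega>. \<Phi> x t (case_nat e \<omega>) \<partial>tcp_clocks) \<partial>clock)"
    by (rule integral_clocks_iter[OF _ bd]) measurable
  also have "\<dots> = (\<integral>e. (if tcp_wait x e \<le> t
      then \<integral>\<omega>. \<Phi> ((x + tcp_wait x e) / 2) (t - tcp_wait x e) \<omega> \<partial>tcp_clocks else c) \<partial>clock)"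
  proof (rule integral_cong_AE)
    have "AE e in clock. 0 \<le> e"
      by (subst AE_density) (auto simp: exponential_density_def)
    then show "AE e in clock. (\<integral>\<omega>. \<Phi> x t (case_nat e \<omega>) \<partial>tcp_clocks) = (if tcp_wait x e \<le> t
      then \<integral>\<omega>. \<Phi> ((x + tcp_wait x e) / 2) (t - tcp_wait x e) \<omega> \<partial>tcp_clocks else c)"
    proof eventually_elim
      case (elim e)
      have "(\<integral>\<omega>. \<Phi> x t (case_nat e \<omega>) \<partial>tcp_clocks) = (\<integral>\<omega>. (if tcp_wait x e \<le> t
        then \<Phi> ((x + tcp_wait x e) / 2) (t - tcp_wait x e) \<omega> else c) \<partial>tcp_clocks)"
        by (rule integral_cong_AE) (use step[OF elim] in \<open>measurable\<close>)
      then show ?case by (simp add: clocks.prob_space[simplified])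
    qed
  qed measurable
  also have "\<dots> = exp (- hazard x t) * c +
    first_jump x t (\<lambda>w. \<integral>\<omega>. \<Phi> ((x + w) / 2) (t - w) \<omega> \<partial>tcp_clocks)"
    by (rule integral_clock_first_jump[OF m3]) (use assms le in \<open>auto\<close>)
  finally show ?thesis .
qed

section \<open>Restarting along the flow, uniqueness for renewal equations, non-explosion\<close>

lemma hazard_add: "hazard x (s + t) = hazard x s + hazard (x + s) t"
  by (simp add: hazard_def power2_eq_square field_simps)

lemma jump_density_add: "jump_density x (s + w) = exp (- hazard x s) * jump_density (x + s) w"
  by (simp add: jump_density_def hazard_add exp_add[symmetric] algebra_simps)

lemma hazard_le: 
  assumes "0 \<le> x" "0 \<le> t" "x + t \<le> K"
  shows "hazard x t \<le> K\<^sup>2 / 2"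
proof -
  have "hazard x t \<le> (x + t)\<^sup>2 / 2" by (simp add: hazard_def power2_sum)
  also have "\<dots> \<le> K\<^sup>2 / 2" using assms by (intro divide_right_mono power_mono) auto
  finally show ?thesis .
qed

lemma first_jump_add:
  assumes G [measurable]: "G \<in> borel_measurable borel" and bd: "\<And>w. 0 \<le> w \<Longrightarrow> w \<le> s + t \<Longrightarrow> \<bar>G w\<bar> \<le> B"
    and "0 \<le> x" "0 \<le> s" "0 \<le> t"
  shows "first_jump x (s + t) G
    = first_jump x s G + exp (- hazard x s) * first_jump (x + s) t (\<lambda>w. G (s + w))"
proof -
  let ?f = "\<lambda>w. jump_density x w * G w"
  have i: "integrable lborel (\<lambda>w. indicator {0..s + t} w * ?f w)"
    by (rule first_jump_integrable[OF G]) (use assms in auto)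
  have i1: "integrable lborel (\<lambda>w. indicator {0..s} w * ?f w)"
    by (rule first_jump_integrable[OF G, where B = B]) (use assms in auto)
  have i2: "integrable lborel (\<lambda>w. indicator {s..s + t} w * ?f w)"
    by (rule Bochner_Integration.integrable_bound[OF i])
      (use assms in \<open>auto simp: indicator_def\<close>)
  have "first_jump x (s + t) G
      = (\<integral>w. indicator {0..s} w * ?f w + indicator {s..s + t} w * ?f w \<partial>lborel)"
    unfolding first_jump_def
  proof (rule integral_cong_AE)
    have "AE w in lborel. w \<noteq> s" by (rule AE_lborel_singleton)
    then show "AE w in lborel. indicator {0..s + t} w * ?f w
        = indicator {0..s} w * ?f w + indicator {s..s + t} w * ?f w"
      by eventually_elim (use assms in \<open>auto simp: indicator_def\<close>)
  qed measurable
  also have "\<dots> = first_jump x s G + (\<integral>w. indicator {s..s + t} w * ?f w \<partial>lborel)"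
    unfolding first_jump_def by (rule Bochner_Integration.integral_add[OF i1 i2])
  also have "(\<integral>w. indicator {s..s + t} w * ?f w \<partial>lborel)
      = (\<integral>w. indicator {s..s + t} (s + 1 * w) * ?f (s + 1 * w) \<partial>lborel)"
    by (subst lborel_integral_real_affine[where c = 1 and t = s]) auto
  also have "\<dots> = (\<integral>w. exp (- hazard x s) * (indicator {0..t} w * (jump_density (x + s) w * G (s + w))) \<partial>lborel)"
    by (intro Bochner_Integration.integral_cong) (auto simp: indicator_def jump_density_add)
  also have "\<dots> = exp (- hazard x s) * first_jump (x + s) t (\<lambda>w. G (s + w))"
    unfolding first_jump_def by (rule integral_mult_right_zero)
  finally show ?thesis .
qed

text \<open>The first-jump operator contracts on the region \<open>x + t \<le> K\<close>, which the flow and the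
  jumps do not leave.\<close>

lemma renewal_uniqueness:
  fixes e :: "real \<Rightarrow> real \<Rightarrow> real"
  assumes bd: "\<And>x t. 0 \<le> x \<Longrightarrow> 0 \<le> t \<Longrightarrow> \<bar>e x t\<bar> \<le> B"
    and step: "\<And>\<theta> x t. 0 \<le> x \<Longrightarrow> 0 \<le> t \<Longrightarrow> x + t \<le> K \<Longrightarrow> 0 \<le> \<theta> \<Longrightarrow>
      (\<And>w. 0 \<le> w \<Longrightarrow> w \<le> t \<Longrightarrow> \<bar>e ((x + w) / 2) (t - w)\<bar> \<le> \<theta>) \<Longrightarrow>
      \<bar>e x t\<bar> \<le> \<theta> * (1 - exp (- hazard x t))"
    and "0 \<le> x" "0 \<le> t" "x + t \<le> K"
  shows "e x t = 0"
proof -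
  \<comment> \<open>On the region the hazard is at most \<open>K\<^sup>2 / 2\<close>, so
    \<open>q\<close> bounds the probability of a jump uniformly, and each pass through
    \<open>step\<close> gains a factor \<open>q\<close>.\<close>
  define q where "q = 1 - exp (- (K\<^sup>2 / 2))"
  have q: "0 \<le> q" "q < 1" by (auto simp: q_def)
  have B: "0 \<le> B" using bd[OF assms(3,4)] by linarith
  have le: "\<bar>e x t\<bar> \<le> B * q ^ n" if "0 \<le> x" "0 \<le> t" "x + t \<le> K" for n x t
    using that
  proof (induction n arbitrary: x t)
    case 0
    then show ?case by (simp add: bd)
  next
    case (Suc n)
    have "\<bar>e x t\<bar> \<le> B * q ^ n * (1 - exp (- hazard x t))"
      by (rule step) (use Suc B q in \<open>auto intro!: Suc.IH simp: field_simps\<close>)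
    also have "\<dots> \<le> B * q ^ n * q"
      using hazard_le[OF Suc.prems] B q by (intro mult_left_mono) (auto simp: q_def)
    finally show ?case by (simp add: mult_ac)
  qed
  have "(\<lambda>n. B * q ^ n) \<longlonglongrightarrow> B * 0"
    using q by (intro tendsto_mult_left LIMSEQ_realpow_zero)
  then have "\<bar>e x t\<bar> \<le> B * 0"
    by (rule LIMSEQ_le_const) (use le assms in blast)
  then show ?thesis by simp
qed

lemma measurable_tcp_process_joint [measurable]:
  "(\<lambda>(x, t, \<omega>). tcp_process x \<omega> t) \<in> borel_measurable (borel \<Otimes>\<^sub>M borel \<Otimes>\<^sub>M tcp_clocks)"
proof -
  have [measurable]: "(\<lambda>p. tcp_count (fst p) (snd (snd p)) (fst (snd p)))
      \<in> measurable (borel \<Otimes>\<^sub>M borel \<Otimes>\<^sub>M tcp_clocks) (count_space UNIV)"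
    unfolding tcp_count_def by measurable
  show ?thesis unfolding tcp_process_def split_beta' by measurable
qed

text \<open>The probability of infinitely many jumps satisfies the renewal equation with no-jump
  value \<open>0\<close>, so uniqueness makes it vanish.\<close>

lemma AE_finite_jumps:
  assumes "0 \<le> x" "0 \<le> t"
  shows "AE \<omega> in tcp_clocks. finite (jumps_upto x \<omega> t)"
proof -
  define \<Phi> where "\<Phi> x t \<omega> = (indicator {\<omega>. infinite (jumps_upto x \<omega> t)} \<omega> :: real)" for x t \<omega>
  have m: "(\<lambda>(x, t, \<omega>). \<Phi> x t \<omega>) \<in> borel_measurable (borel \<Otimes>\<^sub>M borel \<Otimes>\<^sub>M tcp_clocks)"
    unfolding \<Phi>_def jumps_upto_def infinite_nat_iff_unbounded_le indicator_def mem_Collect_eq by measurable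
  have bd: "\<bar>\<Phi> x t \<omega>\<bar> \<le> 1" for x t \<omega> by (simp add: \<Phi>_def)
  define e where "e x t = (\<integral>\<omega>. \<Phi> x t \<omega> \<partial>tcp_clocks)" for x t
  have m': "(\<lambda>w. e ((x + w) / 2) (t - w)) \<in> borel_measurable borel" for x t
  proof -
    have "(\<lambda>(w, \<omega>). \<Phi> ((x + w) / 2) (t - w) \<omega>) \<in> borel_measurable (borel \<Otimes>\<^sub>M tcp_clocks)"
      using measurable_compose[OF _ m, of "\<lambda>(w, \<omega>). ((x + w) / 2, t - w, \<omega>)"
        "borel \<Otimes>\<^sub>M tcp_clocks"] by (simp add: split_beta')
    from clocks.borel_measurable_lebesgue_integral[OF this] show ?thesis by (simp add: e_def)
  qed
  have "e x t = 0"
  proof (rule renewal_uniqueness[where e = e and x = x and t = t and K = "x + t" and B = 1])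
    show "\<bar>e x t\<bar> \<le> 1" for x t
      unfolding e_def by (rule clocks.abs_expectation_le) (rule bd)
    fix \<theta> x t :: real
    assume *: "0 \<le> x" "0 \<le> t" and \<theta>: "\<And>w. 0 \<le> w \<Longrightarrow> w \<le> t \<Longrightarrow> \<bar>e ((x + w) / 2) (t - w)\<bar> \<le> \<theta>"
    have "e x t = exp (- hazard x t) * 0 + first_jump x t (\<lambda>w. e ((x + w) / 2) (t - w))"
      unfolding e_def
    proof (rule expectation_first_jump[OF m bd *])
      fix s :: real assume s: "0 \<le> s"
      show "AE \<omega> in tcp_clocks. \<Phi> x t (case_nat s \<omega>) = (if tcp_wait x s \<le> t
          then \<Phi> ((x + tcp_wait x s) / 2) (t - tcp_wait x s) \<omega> else 0)"
        using AE_clocks_nonneg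
      proof eventually_elim
        case (elim \<omega>)
        then have "0 \<le> \<omega> i" for i by simp
        from jumps_upto_case_nat[OF *(1) s this] show ?case
          by (auto simp: \<Phi>_def indicator_def dest: finite_imageD)
      qed
    qed
    then show "\<bar>e x t\<bar> \<le> \<theta> * (1 - exp (- hazard x t))"
      using first_jump_bound[OF m' * \<theta>] by simp
  qed (use assms in auto)
  then have "AE \<omega> in tcp_clocks. \<Phi> x t \<omega> = 0"
    unfolding e_def
  proof (subst (asm) integral_nonneg_eq_0_iff_AE)
    have "(\<lambda>\<omega>. \<Phi> x t \<omega>) \<in> borel_measurable tcp_clocks"
      using measurable_compose[OF _ m, of "\<lambda>\<omega>. (x, t, \<omega>)" tcp_clocks] by simp
    then show "integrable tcp_clocks (\<Phi> x t)"
      by (intro clocks.integrable_const_bound[where B = 1]) (auto simp: bd)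
  qed (auto simp: \<Phi>_def)
  then show ?thesis by eventually_elim (auto simp: \<Phi>_def indicator_def split: if_splits)
qed

subsection \<open>The semigroup\<close>

lemma tcp_op_measurable_joint:
  assumes [measurable]: "f \<in> borel_measurable borel"
  shows "(\<lambda>(x, t). tcp_op t f x) \<in> borel_measurable (borel \<Otimes>\<^sub>M borel)"
proof -
  have "(\<lambda>(p, \<omega>). f (tcp_process (fst p) \<omega> (snd p))) \<in> borel_measurable ((borel \<Otimes>\<^sub>M borel) \<Otimes>\<^sub>M tcp_clocks)"
    using measurable_compose[OF measurable_compose[OF _ measurable_tcp_process_joint] assms,
        of "\<lambda>(p, \<omega>). (fst p, snd p, \<omega>)" "(borel \<Otimes>\<^sub>M borel) \<Otimes>\<^sub>M tcp_clocks"] by (simp add: split_beta')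
  from clocks.borel_measurable_lebesgue_integral[OF this] show ?thesis
    by (simp add: tcp_op_def split_beta')
qed

lemma tcp_op_measurable [measurable (raw)]:
  assumes "f \<in> borel_measurable borel" and [measurable]: "g \<in> borel_measurable M" "h \<in> borel_measurable M"
  shows "(\<lambda>y. tcp_op (g y) f (h y)) \<in> borel_measurable M"
  using measurable_compose[OF _ tcp_op_measurable_joint[OF assms(1)], of "\<lambda>y. (h y, g y)" M] by simp

lemma tcp_op_bound:
  assumes "\<And>x. \<bar>f x\<bar> \<le> B"
  shows "\<bar>tcp_op t f x\<bar> \<le> B"
  unfolding tcp_op_def by (rule clocks.abs_expectation_le) (rule assms)

lemma tcp_op_renewal:
  assumes f [measurable]: "f \<in> borel_measurable borel" and bd: "\<And>x. \<bar>f x\<bar> \<le> B"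
    and x: "0 \<le> x" "0 \<le> t"
  shows "tcp_op t f x = exp (- hazard x t) * f (x + t)
    + first_jump x t (\<lambda>w. tcp_op (t - w) f ((x + w) / 2))"
  unfolding tcp_op_def
proof (rule expectation_first_jump[where B = B])
  show "(\<lambda>(x, t, \<omega>). f (tcp_process x \<omega> t)) \<in> borel_measurable (borel \<Otimes>\<^sub>M borel \<Otimes>\<^sub>M tcp_clocks)"
    using measurable_compose[OF measurable_tcp_process_joint f] by (simp add: split_beta')
  fix e :: real assume e: "0 \<le> e"
  let ?w = "tcp_wait x e"
  have w: "0 \<le> ?w" using x(1) e by (rule tcp_wait_solves)
  show "AE \<omega> in tcp_clocks. f (tcp_process x (case_nat e \<omega>) t) =
      (if ?w \<le> t then f (tcp_process ((x + ?w) / 2) \<omega> (t - ?w)) else f (x + t))"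
  proof (cases "?w \<le> t")
    case True
    have "AE \<omega> in tcp_clocks. finite (jumps_upto ((x + ?w) / 2) \<omega> (t - ?w))"
      using x w True by (intro AE_finite_jumps) auto
    with AE_clocks_nonneg show ?thesis
      by eventually_elim (simp add: tcp_process_case_nat x e True)
  next
    \<comment> \<open>Now \<open>t - ?w\<close> is negative and \<open>AE_finite_jumps\<close> does
      not apply; the jump set is empty because jump times are nonnegative.\<close>
    case False
    from AE_clocks_nonneg show ?thesis
    proof eventually_elim
      case (elim \<omega>)
      have "0 \<le> tcp_time ((x + ?w) / 2) \<omega> (Suc n)" for n
        using x w elim by (intro tcp_time_nonneg) auto
      then have "\<not> tcp_time ((x + ?w) / 2) \<omega> (Suc n) \<le> t - ?w" for n
        using False by (meson diff_less_0_iff_less leD le_less_trans not_le)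
      then have "jumps_upto ((x + ?w) / 2) \<omega> (t - ?w) = {}"
        by (simp add: jumps_upto_def)
      then show ?case using False elim x e by (simp add: tcp_process_case_nat)
    qed
  qed
qed (use bd x in auto)

text \<open>The no-jump mass and the mass of \<open>first_jump\<close> add up to \<open>1\<close>,
  so any constant can be subtracted; later estimates choose \<open>c\<close> to make the terms
  small.\<close>

lemma tcp_op_renewal_centered:
  assumes f [measurable]: "f \<in> borel_measurable borel" and bd: "\<And>x. \<bar>f x\<bar> \<le> B"
    and x: "0 \<le> x" "0 \<le> t"
  shows "tcp_op t f x - c = exp (- hazard x t) * (f (x + t) - c)
    + first_jump x t (\<lambda>w. tcp_op (t - w) f ((x + w) / 2) - c)"
proof -
  have "first_jump x t (\<lambda>w. tcp_op (t - w) f ((x + w) / 2) - c)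
      = first_jump x t (\<lambda>w. tcp_op (t - w) f ((x + w) / 2)) - c * (1 - exp (- hazard x t))"
    using x by (subst first_jump_diff[where B = B and B' = "\<bar>c\<bar>"])
      (auto simp: tcp_op_bound[of f, OF bd] first_jump_const)
  then show ?thesis
    unfolding tcp_op_renewal[OF f bd x] by (simp add: algebra_simps)
qed

text \<open>Jumps only lower the position, so paths stay in \<open>[0, x + t]\<close>. The proof
  avoids paths: uniqueness is applied to the excess over \<theta>. It serves as a maximum principle,
  from which positivity and monotonicity of \<open>tcp_op\<close> are derived.\<close>

lemma tcp_op_near:
  assumes f [measurable]: "f \<in> borel_measurable borel" and bd: "\<And>x. \<bar>f x\<bar> \<le> B"
    and "0 \<le> x" "0 \<le> t" and near: "\<And>a. 0 \<le> a \<Longrightarrow> a \<le> x + t \<Longrightarrow> \<bar>f a - c\<bar> \<le> \<theta>"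
  shows "\<bar>tcp_op t f x - c\<bar> \<le> \<theta>"
proof -
  define e where "e y s = max 0 (\<bar>tcp_op s f y - c\<bar> - \<theta>)" for y s
  have \<theta>: "0 \<le> \<theta>" using near[of 0] assms(3,4) by auto
  have "e x t = 0"
  proof (rule renewal_uniqueness[where e = e and x = x and t = t and K = "x + t" and B = "B + \<bar>c\<bar>"])
    show "\<bar>e x t\<bar> \<le> B + \<bar>c\<bar>" for x t
      using tcp_op_bound[of f, OF bd, of t x] \<theta> by (simp add: e_def)
    fix \<theta>' y s :: real
    assume *: "0 \<le> y" "0 \<le> s" "y + s \<le> x + t" "0 \<le> \<theta>'"
      and h: "\<And>w. 0 \<le> w \<Longrightarrow> w \<le> s \<Longrightarrow> \<bar>e ((y + w) / 2) (s - w)\<bar> \<le> \<theta>'"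
    let ?E = "exp (- hazard y s)"
    have h': "\<bar>tcp_op (s - w) f ((y + w) / 2) - c\<bar> \<le> \<theta> + \<theta>'" if "0 \<le> w" "w \<le> s" for w
      using h[OF that] by (simp add: e_def)
    have "tcp_op s f y - c = ?E * (f (y + s) - c)
        + first_jump y s (\<lambda>w. tcp_op (s - w) f ((y + w) / 2) - c)"
      by (rule tcp_op_renewal_centered[OF f bd *(1,2)])
    also have "\<bar>\<dots>\<bar> \<le> ?E * \<theta> + (\<theta> + \<theta>') * (1 - ?E)"
    proof (rule order_trans[OF abs_triangle_ineq add_mono])
      show "\<bar>?E * (f (y + s) - c)\<bar> \<le> ?E * \<theta>"
        using near[of "y + s"] * by (simp add: abs_mult)
      show "\<bar>first_jump y s (\<lambda>w. tcp_op (s - w) f ((y + w) / 2) - c)\<bar> \<le> (\<theta> + \<theta>') * (1 - ?E)"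
        by (rule first_jump_bound) (use * h' in auto)
    qed
    finally have "\<bar>tcp_op s f y - c\<bar> - \<theta> \<le> \<theta>' * (1 - ?E)"
      by (simp add: algebra_simps)
    moreover have "0 \<le> \<theta>' * (1 - ?E)" using * hazard_nonneg[of y s] by simp
    ultimately show "\<bar>e y s\<bar> \<le> \<theta>' * (1 - ?E)" by (simp add: e_def)
  qed (use assms in auto)
  then show ?thesis by (simp add: e_def max_def split: if_splits)
qed

text \<open>Both sides satisfy the same renewal equation in \<open>s\<close>: on the left the
  first-jump integral is cut at time \<open>s\<close>, and the late part together with the no-jump
  term reassembles into \<open>tcp_op t f (x + s)\<close>. Uniqueness kills the difference.\<close>

lemma tcp_op_semigroup:
  assumes f [measurable]: "f \<in> borel_measurable borel" and bd: "\<And>x. \<bar>f x\<bar> \<le> B"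
    and "0 \<le> x" "0 \<le> s" "0 \<le> t"
  shows "tcp_op (s + t) f x = tcp_op s (tcp_op t f) x"
proof -
  define e where "e x s = tcp_op (s + t) f x - tcp_op s (tcp_op t f) x" for x s
  have bd': "\<bar>tcp_op s f y\<bar> \<le> B" for s y by (rule tcp_op_bound) (rule bd)
  have bd'': "\<bar>tcp_op s (tcp_op t f) y\<bar> \<le> B" for s y by (rule tcp_op_bound) (rule bd')
  have "e x s = 0"
  proof (rule renewal_uniqueness[where e = e and x = x and t = s and K = "x + s" and B = "2 * B"])
    show "\<bar>e x s\<bar> \<le> 2 * B" for x s
      unfolding e_def using bd'[of "s + t" x] bd''[of s x] by linarith
    fix \<theta> y r :: real
    assume *: "0 \<le> y" "0 \<le> r" and h: "\<And>w. 0 \<le> w \<Longrightarrow> w \<le> r \<Longrightarrow> \<bar>e ((y + w) / 2) (r - w)\<bar> \<le> \<theta>"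
    let ?E = "exp (- hazard y r)"
    let ?G = "\<lambda>w. tcp_op (r + t - w) f ((y + w) / 2)"
    let ?G' = "\<lambda>w. tcp_op (r - w) (tcp_op t f) ((y + w) / 2)"
    have "tcp_op (r + t) f y = exp (- hazard y (r + t)) * f (y + (r + t)) + first_jump y (r + t) ?G"
      using * assms by (intro tcp_op_renewal) auto
    also have "\<dots> = exp (- hazard y (r + t)) * f (y + (r + t)) + first_jump y r ?G
        + ?E * first_jump (y + r) t (\<lambda>w. ?G (r + w))"
      using * assms by (subst first_jump_add[where B = B]) (auto simp: bd')
    also have "exp (- hazard y (r + t)) * f (y + (r + t)) + first_jump y r ?G
        + ?E * first_jump (y + r) t (\<lambda>w. ?G (r + w)) = ?E * tcp_op t f (y + r) + first_jump y r ?G"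
      using * assms by (subst (3) tcp_op_renewal[OF f bd])
        (auto simp: hazard_add exp_add[symmetric] algebra_simps)
    finally have 1: "tcp_op (r + t) f y = ?E * tcp_op t f (y + r) + first_jump y r ?G" .
    have 2: "tcp_op r (tcp_op t f) y = ?E * tcp_op t f (y + r) + first_jump y r ?G'"
      by (rule tcp_op_renewal) (use * bd' in auto)
    have "e y r = first_jump y r (\<lambda>w. ?G w - ?G' w)"
      using * unfolding e_def 1 2 by (subst first_jump_diff[where B = B and B' = B]) (auto simp: bd' bd'')
    also have "\<bar>\<dots>\<bar> \<le> \<theta> * (1 - ?E)"
    proof (rule first_jump_bound)
      show "\<bar>?G w - ?G' w\<bar> \<le> \<theta>" if "0 \<le> w" "w \<le> r" for w
        using h[OF that] by (simp add: e_def algebra_simps)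
    qed (use * in auto)
    finally show "\<bar>e y r\<bar> \<le> \<theta> * (1 - ?E)" .
  qed (use assms in auto)
  then show ?thesis by (simp add: e_def)
qed

text \<open>Centering at \<open>f (x + t)\<close> removes the no-jump term, so only the probability
  of a jump remains. At \<open>t = 0\<close> it says that \<open>tcp_op 0\<close> is the
  identity.\<close>

lemma tcp_op_flow:
  assumes f [measurable]: "f \<in> borel_measurable borel" and bd: "\<And>x. \<bar>f x\<bar> \<le> B"
    and x: "0 \<le> x" "0 \<le> t"
    and osc: "\<And>a. 0 \<le> a \<Longrightarrow> a \<le> x + t \<Longrightarrow> \<bar>f a - f (x + t)\<bar> \<le> \<Omega>"
  shows "\<bar>tcp_op t f x - f (x + t)\<bar> \<le> \<Omega> * (1 - exp (- hazard x t))"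
proof -
  have "tcp_op t f x - f (x + t)
      = first_jump x t (\<lambda>w. tcp_op (t - w) f ((x + w) / 2) - f (x + t))"
    using tcp_op_renewal_centered[OF f bd x, of "f (x + t)"] by simp
  also have "\<bar>\<dots>\<bar> \<le> \<Omega> * (1 - exp (- hazard x t))"
  proof (rule first_jump_bound)
    show "\<bar>tcp_op (t - w) f ((x + w) / 2) - f (x + t)\<bar> \<le> \<Omega>" if "0 \<le> w" "w \<le> t" for w
      using that x by (intro tcp_op_near[OF f bd] osc) (auto simp: field_simps)
  qed (use x in auto)
  finally show ?thesis .
qed

lemma tcp_op_diff:
  assumes [measurable]: "f \<in> borel_measurable borel" "g \<in> borel_measurable borel"
    and "\<And>x. \<bar>f x\<bar> \<le> B" "\<And>x. \<bar>g x\<bar> \<le> B'"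
  shows "tcp_op t (\<lambda>x. f x - g x) x = tcp_op t f x - tcp_op t g x"
proof -
  have [measurable]: "(\<lambda>\<omega>. tcp_process x \<omega> t) \<in> borel_measurable tcp_clocks"
    using measurable_compose[OF _ measurable_tcp_process_joint, of "\<lambda>\<omega>. (x, t, \<omega>)" tcp_clocks] by simp
  have "integrable tcp_clocks (\<lambda>\<omega>. f (tcp_process x \<omega> t))"
    by (rule clocks.integrable_const_bound[where B = B]) (auto simp: assms)
  moreover have "integrable tcp_clocks (\<lambda>\<omega>. g (tcp_process x \<omega> t))"
    by (rule clocks.integrable_const_bound[where B = B']) (auto simp: assms)
  ultimately show ?thesis
    unfolding tcp_op_def by (rule Bochner_Integration.integral_diff)
qed

subsection \<open>Contraction of the Euler scheme\<close>

text \<open>The clamp keeps the jump probability in \<open>[0, 1]\<close> for every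
  \<open>x\<close>, so bounds on \<open>f\<close> are preserved globally; the plain scheme is
  recovered where \<open>0 \<le> x * h\<close> and \<open>x * h \<le> 1\<close>.\<close>

definition euler :: "real \<Rightarrow> (real \<Rightarrow> real) \<Rightarrow> real \<Rightarrow> real" where
  "euler h f x = (1 - max 0 (min 1 (x * h))) * f (x + h) + max 0 (min 1 (x * h)) * f (x / 2 + h)"

lemma euler_measurable:
  assumes [measurable]: "f \<in> borel_measurable borel"
  shows "euler h f \<in> borel_measurable borel"
  unfolding euler_def by measurable

lemma euler_bound:
  assumes "\<And>x. \<bar>f x\<bar> \<le> B"
  shows "\<bar>euler h f x\<bar> \<le> B"
proof -
  define q where "q = max 0 (min 1 (x * h))"
  have q: "0 \<le> q" "q \<le> 1" by (auto simp: q_def)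
  have "\<bar>euler h f x\<bar> \<le> \<bar>(1 - q) * f (x + h)\<bar> + \<bar>q * f (x / 2 + h)\<bar>"
    unfolding euler_def q_def by (rule abs_triangle_ineq)
  also have "\<dots> \<le> (1 - q) * B + q * B"
    using q assms by (auto simp: abs_mult intro!: add_mono mult_left_mono)
  finally show ?thesis by (simp add: algebra_simps)
qed

lemma euler_iter_measurable: "f \<in> borel_measurable borel \<Longrightarrow> (euler h ^^ k) f \<in> borel_measurable borel"
  by (induction k) (auto intro: euler_measurable)

lemma euler_iter_bound: "(\<And>x. \<bar>f x\<bar> \<le> B) \<Longrightarrow> \<bar>(euler h ^^ k) f x\<bar> \<le> B"
  by (induction k arbitrary: x) (auto intro!: euler_bound)

lemma hazard_le_mult: "hazard x t \<le> (x + t) * t"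
  using zero_le_power2[of t] by (simp add: hazard_def distrib_right power2_eq_square)

text \<open>Since \<open>1 + a + a\<^sup>2 / 2 \<le> exp a\<close>, it is enough that the two
  quadratics have product at least \<open>1\<close>.\<close>

lemma exp_minus_le_quadratic:
  fixes a :: real
  assumes "0 \<le> a"
  shows "exp (- a) \<le> 1 - a + a\<^sup>2 / 2"
proof -
  have "(1 - a + a\<^sup>2 / 2) * (1 + a + a\<^sup>2 / 2) = 1 + (a\<^sup>2)\<^sup>2 / 4"
    by (simp add: power2_eq_square field_simps)
  moreover have "0 \<le> 1 - a + a\<^sup>2 / 2"
    using zero_le_power2[of "a - 1"] by (simp add: power2_diff)
  moreover have "1 + a + a\<^sup>2 / 2 \<le> exp a"
    using exp_lower_Taylor_quadratic[OF assms] by simp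
  ultimately have "1 + (a\<^sup>2)\<^sup>2 / 4 \<le> (1 - a + a\<^sup>2 / 2) * exp a"
    using mult_left_mono by fastforce
  then have "1 \<le> (1 - a + a\<^sup>2 / 2) * exp a"
    using zero_le_power2[of "a\<^sup>2"] by linarith
  then show ?thesis by (simp add: exp_minus divide_simps mult.commute)
qed

text \<open>A jump has probability of order \<open>h\<close> and, if single, misplaces the endpoint
  by order \<open>h\<close>; square-root regularity turns this into \<open>h * sqrt h\<close>, which
  still vanishes after summing over order \<open>1 / h\<close> steps. The powers of \<open>K\<close>
  are crude.\<close>

lemma tcp_op_euler_step:
  assumes f [measurable]: "f \<in> borel_measurable borel" and bd: "\<And>x. \<bar>f x\<bar> \<le> B"
    and x: "0 \<le> x" "0 \<le> h" "h \<le> 1" "x * h \<le> 1" and K: "x + h \<le> K" "1 \<le> K" and H: "0 \<le> H"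
    and hoelder: "\<And>a b. 0 \<le> a \<Longrightarrow> a \<le> b \<Longrightarrow> b \<le> x + h \<Longrightarrow> \<bar>f a - f b\<bar> \<le> H * sqrt (b - a)"
  shows "\<bar>tcp_op h f x - euler h f x\<bar> \<le> 3 * K ^ 3 * H * (h * sqrt h)"
proof -
  \<comment> \<open>The value of the scheme on its jump branch, as if the jump came at the start of
    the step.\<close>
  define c where "c = f (x / 2 + h)"
  define A where "A = hazard x h"
  have A: "0 \<le> A" "A \<le> K * h" "A = x * h + h\<^sup>2 / 2"
  proof -
    show "0 \<le> A" unfolding A_def using x by (intro hazard_nonneg) auto
    show "A = x * h + h\<^sup>2 / 2" by (simp add: A_def hazard_def)
    have "A \<le> (x + h) * h" unfolding A_def by (rule hazard_le_mult)
    also have "\<dots> \<le> K * h" using K x by (intro mult_right_mono) auto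
    finally show "A \<le> K * h" .
  qed
  have sh: "h \<le> sqrt h" "h\<^sup>2 \<le> h * sqrt h"
  proof -
    show "h \<le> sqrt h" using x by (intro real_le_rsqrt) (auto simp: power2_eq_square mult_left_le)
    then show "h\<^sup>2 \<le> h * sqrt h" using x by (simp add: power2_eq_square mult_left_mono)
  qed
  have sq: "sqrt (b - a) \<le> K" if "0 \<le> a" "a \<le> b" "b \<le> x + h" for a b
  proof -
    have "b - a \<le> K" "K \<le> K\<^sup>2" using that K by (auto simp: power2_eq_square)
    then show ?thesis using K by (intro real_le_lsqrt) auto
  qed
  have osc: "\<bar>f a - f b\<bar> \<le> H * K" if "0 \<le> a" "a \<le> b" "b \<le> x + h" for a b
    using hoelder[OF that] mult_left_mono[OF sq[OF that] H] by linarith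
  have 1: "tcp_op h f x - euler h f x = (exp (- A) - (1 - x * h)) * (f (x + h) - c)
      + first_jump x h (\<lambda>w. tcp_op (h - w) f ((x + w) / 2) - c)"
  proof -
    have "euler h f x = (1 - x * h) * f (x + h) + x * h * c"
      using x by (simp add: euler_def c_def)
    then show ?thesis
      using tcp_op_renewal_centered[OF f bd x(1,2), of c] by (simp add: A_def algebra_simps)
  qed
  have 2: "\<bar>(exp (- A) - (1 - x * h)) * (f (x + h) - c)\<bar> \<le> K\<^sup>2 * h\<^sup>2 * (H * K)"
  proof -
    have "1 - A \<le> exp (- A)" using exp_ge_add_one_self[of "- A"] by simp
    moreover have "exp (- A) \<le> 1 - A + A\<^sup>2 / 2" by (rule exp_minus_le_quadratic) (rule A)
    moreover have "A\<^sup>2 \<le> (K * h)\<^sup>2" using A by (intro power_mono)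
    moreover have "h\<^sup>2 \<le> (K * h)\<^sup>2" using K x by (intro power_mono) (auto simp: mult_le_cancel_right1)
    moreover have "x * h = A - h\<^sup>2 / 2" using A(3) by simp
    ultimately have "\<bar>exp (- A) - (1 - x * h)\<bar> \<le> (K * h)\<^sup>2"
      using zero_le_power2[of h] by linarith
    moreover have "\<bar>f (x + h) - c\<bar> \<le> H * K"
      using osc[of "x / 2 + h" "x + h"] x by (simp add: c_def abs_minus_commute)
    ultimately show ?thesis unfolding abs_mult by (intro mult_mono) (auto simp: power_mult_distrib)
  qed
  have 3: "\<bar>first_jump x h (\<lambda>w. tcp_op (h - w) f ((x + w) / 2) - c)\<bar>
      \<le> (2 * K\<^sup>2 * H * sqrt h) * (1 - exp (- A))"
    unfolding A_def
  proof (rule first_jump_bound)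
    \<comment> \<open>After a jump at time \<open>w\<close> the flow ends at
      \<open>x / 2 + h - w / 2\<close>, within \<open>w / 2\<close> of the point defining
      \<open>c\<close>; a second jump inside the step costs another factor of order
      \<open>h\<close>.\<close>
    fix w assume w: "0 \<le> w" "w \<le> h"
    let ?z = "(x + w) / 2" and ?u = "h - w"
    have zu: "?z + ?u = x / 2 + h - w / 2" by (simp add: field_simps)
    have "\<bar>tcp_op ?u f ?z - f (?z + ?u)\<bar> \<le> H * K * (1 - exp (- hazard ?z ?u))"
      by (rule tcp_op_flow[OF f bd]) (use x w in \<open>auto intro!: osc\<close>)
    also have "\<dots> \<le> H * K * (K * sqrt h)"
    proof (rule mult_left_mono)
      have "1 - exp (- hazard ?z ?u) \<le> hazard ?z ?u"
        using exp_ge_add_one_self[of "- hazard ?z ?u"] by simp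
      also have "\<dots> \<le> (?z + ?u) * ?u"
        by (rule hazard_le_mult)
      also have "\<dots> \<le> K * h" using w x K by (intro mult_mono) (auto simp: zu)
      also have "\<dots> \<le> K * sqrt h" using sh K by (intro mult_left_mono) auto
      finally show "1 - exp (- hazard ?z ?u) \<le> K * sqrt h" .
    qed (use H K in auto)
    finally have a: "\<bar>tcp_op ?u f ?z - f (?z + ?u)\<bar> \<le> K\<^sup>2 * H * sqrt h"
      by (simp add: power2_eq_square mult_ac)
    have "\<bar>f (?z + ?u) - c\<bar> \<le> H * sqrt (w / 2)"
      using hoelder[of "?z + ?u" "x / 2 + h"] w x unfolding c_def zu by (auto simp: field_simps)
    also have "\<dots> \<le> H * (K\<^sup>2 * sqrt h)"
    proof (rule mult_left_mono[OF _ H])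
      have "sqrt (w / 2) \<le> 1 * sqrt h" using w by simp
      also have "\<dots> \<le> K\<^sup>2 * sqrt h" using K x by (intro mult_right_mono) (auto simp: one_le_power)
      finally show "sqrt (w / 2) \<le> K\<^sup>2 * sqrt h" .
    qed
    finally show "\<bar>tcp_op ?u f ?z - c\<bar> \<le> 2 * K\<^sup>2 * H * sqrt h"
      using a by (simp add: mult_ac abs_le_iff)
  qed (use x f in \<open>auto\<close>)
  have "1 - exp (- A) \<le> K * h"
    using exp_ge_add_one_self[of "- A"] A by linarith
  then have "(2 * K\<^sup>2 * H * sqrt h) * (1 - exp (- A)) \<le> (2 * K\<^sup>2 * H * sqrt h) * (K * h)"
    using K H x by (intro mult_left_mono) auto
  moreover have "K\<^sup>2 * h\<^sup>2 * (H * K) \<le> K\<^sup>2 * (h * sqrt h) * (H * K)"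
    using sh K H by (intro mult_left_mono mult_right_mono) auto
  ultimately show ?thesis
    using 1 2 3 by (simp add: power2_eq_square power3_eq_cube mult_ac abs_le_iff)
qed

text \<open>The contracted distance is \<open>sqrt \<bar>x - y\<bar> * weight (max x y)\<close>: the drift decreases the
  weight near 0, where jumps are rare, and jumps contract the square root elsewhere.\<close>

definition weight :: "real \<Rightarrow> real" where
  "weight y = 1 + 1 / (1 + y)"

lemma weight_bounds: "0 \<le> y \<Longrightarrow> 1 \<le> weight y" "0 \<le> y \<Longrightarrow> weight y \<le> 2"
  by (auto simp: weight_def)

lemma weight_antimono: "0 \<le> x \<Longrightarrow> x \<le> y \<Longrightarrow> weight y \<le> weight x"
  by (auto simp: weight_def intro!: divide_left_mono)

text \<open>The constant \<open>21 / 25\<close> is slightly above the maximum of the left-hand side for \<open>x + d = 1\<close>,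
  which is the constant \<open>M\<close> of the theorem.\<close>

lemma jump_ratio_bound:
  assumes "0 \<le> x" "0 \<le> d"
  shows "x / sqrt 2 + sqrt (d * \<bar>x - d\<bar> / 2) \<le> 21 / 25 * (x + d)"
proof -
  have "sqrt 2 \<le> (142 / 100 :: real)" by (intro real_le_lsqrt) (auto simp: power2_eq_square)
  moreover have "1 / sqrt 2 = (2 / sqrt 2) / (2 :: real)" by simp
  then have "1 / sqrt 2 = sqrt 2 / (2 :: real)" by (subst (asm) real_div_sqrt) auto
  ultimately have s2: "1 / sqrt 2 \<le> (71 / 100 :: real)" by simp
  \<comment> \<open>\<open>13 / 100 = 21 / 25 - 71 / 100\<close> is the coefficient of
    \<open>x\<close> left after bounding \<open>x / sqrt 2\<close>; what remains is the
    nonnegativity of a quadratic form in \<open>x\<close> and \<open>d\<close>.\<close>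
  have "d * \<bar>x - d\<bar> / 2 \<le> (13 / 100 * x + 21 / 25 * d)\<^sup>2"
  proof (cases "d \<le> x")
    case True
    have "(13 / 100 * x + 21 / 25 * d)\<^sup>2 - d * (x - d) / 2
        = (13 / 100 * x - 352 / 325 * d)\<^sup>2 + (1507 / 1250 - 123904 / 105625) * d\<^sup>2"
      by (simp add: power2_eq_square field_simps)
    moreover have "0 \<le> (13 / 100 * x - 352 / 325 * d)\<^sup>2 + (1507 / 1250 - 123904 / 105625) * d\<^sup>2"
      by (intro add_nonneg_nonneg mult_nonneg_nonneg) auto
    moreover have ab: "\<bar>x - d\<bar> = x - d" using True by simp
    ultimately show ?thesis unfolding ab by linarith
  next
    case False
    have "(13 / 100 * x + 21 / 25 * d)\<^sup>2 - d * (d - x) / 2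
        = 169 / 10000 * x\<^sup>2 + 7184 / 10000 * (x * d) + 2056 / 10000 * d\<^sup>2"
      by (simp add: power2_eq_square field_simps)
    moreover have "0 \<le> 169 / 10000 * x\<^sup>2 + 7184 / 10000 * (x * d) + 2056 / 10000 * d\<^sup>2"
      using assms by (intro add_nonneg_nonneg mult_nonneg_nonneg) auto
    moreover have ab: "\<bar>x - d\<bar> = d - x" using False by simp
    ultimately show ?thesis unfolding ab by linarith
  qed
  then have "sqrt (d * \<bar>x - d\<bar> / 2) \<le> 13 / 100 * x + 21 / 25 * d"
    using assms by (intro real_le_lsqrt) auto
  moreover have "x / sqrt 2 \<le> 71 / 100 * x"
    using mult_left_mono[OF s2 assms(1)] by simp
  ultimately have "x / sqrt 2 + sqrt (d * \<bar>x - d\<bar> / 2) \<le> 71 / 100 * x + (13 / 100 * x + 21 / 25 * d)"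
    by (intro add_mono)
  also have "\<dots> = 21 / 25 * (x + d)" by (simp add: field_simps)
  finally show ?thesis .
qed

text \<open>As \<open>h\<close> tends to 0 this is the generator inequality
  \<open>w'(y) - y w(y) + 21/25 y w(y/2) + 3/20 w(y) \<le> 0\<close> for \<open>w = weight\<close>,
  with \<open>w'(y) = - 1 / (1 + y)\<^sup>2\<close>.\<close>

lemma weight_drift:
  assumes "0 \<le> y" "0 < h" "h \<le> 1 / 50" "y * h \<le> 1"
  shows "(1 - y * h) * weight (y + h) + h * (21 / 25 * y) * weight (y / 2) \<le> (1 - 3 / 20 * h) * weight y"
proof -
  have eq: "weight (y + h) = weight y - h / ((1 + y) * (1 + y + h))"
  proof -
    have "1 / (1 + y + h) = 1 / (1 + y) - h / ((1 + y) * (1 + y + h))"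
    proof -
      let ?P = "(1 + y) * (1 + y + h)"
      have ne: "1 + y \<noteq> 0" "1 + y + h \<noteq> 0" using assms by auto
      have "1 / (1 + y + h) = (1 + y) / ?P" using ne by simp
      also have "\<dots> = (1 + y + h) / ?P - h / ?P"
        by (simp only: diff_divide_distrib[symmetric] add_diff_cancel_right')
      also have "(1 + y + h) / ?P = 1 / (1 + y)" using ne by simp
      finally show ?thesis .
    qed
    then show ?thesis by (simp add: weight_def algebra_simps)
  qed
  have w2: "weight (y / 2) = 1 + 2 / (2 + y)" using assms by (simp add: weight_def field_simps)
  \<comment> \<open>Replacing the difference quotient by the derivative costs at most
    \<open>h / (1 + y)\<close>; the slack \<open>1 / 50 / (1 + y)\<close> in \<open>poly\<close>
    pays for it, which is where \<open>h \<le> 1 / 50\<close> enters.\<close>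
  have 1: "1 / (1 + y)\<^sup>2 - h / (1 + y) \<le> (1 - y * h) / ((1 + y) * (1 + y + h))"
  proof -
    have "(1 - (1 + y) * h) * (1 + y + h) \<le> (1 - y * h) * (1 + y)"
      using assms by (simp add: algebra_simps)
    then have "(1 - (1 + y) * h) / (1 + y)\<^sup>2 \<le> (1 - y * h) / ((1 + y) * (1 + y + h))"
      using assms by (simp add: divide_simps power2_eq_square)
    then show ?thesis using assms by (simp add: diff_divide_distrib power2_eq_square)
  qed
  have poly: "- (y * weight y) + 21 / 25 * y * weight (y / 2) + 3 / 20 * weight y
      - 1 / (1 + y)\<^sup>2 + 1 / 50 / (1 + y) \<le> 0"
  proof -
    \<comment> \<open>The square is chosen to match the coefficients of \<open>y ^ 4\<close> and
      \<open>y ^ 3\<close> and to overshoot that of \<open>y ^ 2\<close> slightly, so the remainder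
      has only negative coefficients.\<close>
    have "0 \<le> (y\<^sup>2 - 19 / 32 * y - 121 / 100)\<^sup>2" "0 \<le> y\<^sup>2" by auto
    moreover have "- 136 / 100 - 38 / 100 * y + 33 / 100 * y ^ 2 + 19 / 100 * y ^ 3 - 16 / 100 * y ^ 4
        = - (16 / 100) * (y\<^sup>2 - 19 / 32 * y - 121 / 100)\<^sup>2 - 1125744 / 1000000
          - 1501 / 10000 * y - 79375 / 100000000 * y\<^sup>2"
      by (simp add: power2_eq_square power3_eq_cube power4_eq_xxxx field_simps)
    ultimately have N: "- 136 / 100 - 38 / 100 * y + 33 / 100 * y ^ 2 + 19 / 100 * y ^ 3 - 16 / 100 * y ^ 4 \<le> 0"
      using assms(1) by linarith
    have "(- (y * weight y) + 21 / 25 * y * weight (y / 2) + 3 / 20 * weight y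
        - 1 / (1 + y)\<^sup>2 + 1 / 50 / (1 + y)) * ((1 + y)\<^sup>2 * (2 + y))
      = - 136 / 100 - 38 / 100 * y + 33 / 100 * y ^ 2 + 19 / 100 * y ^ 3 - 16 / 100 * y ^ 4"
    proof -
      \<comment> \<open>Reciprocals become variables \<open>p\<close> and \<open>r\<close> with
        \<open>p * u = 1\<close> and \<open>r * (2 + y) = 1\<close>, so clearing denominators is a
        ring identity.\<close>
      define u where "u = 1 + y"
      have u: "0 < u" using assms by (auto simp: u_def)
      define p where "p = 1 / u"
      define r where "r = 1 / (2 + y)"
      have pr: "p * u = 1" "r * (2 + y) = 1" using u assms by (auto simp: p_def r_def)
      have e: "2 / (2 + y) = 2 * r" "1 / u = p" "1 / u\<^sup>2 = p\<^sup>2" "1 / 50 / u = p / 50"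
        by (simp_all add: p_def r_def power_one_over)
      have "(- (y * (1 + p)) + 21 / 25 * y * (1 + 2 * r) + 3 / 20 * (1 + p) - p\<^sup>2 + p / 50) * (u\<^sup>2 * (2 + y))
        = - (y * (u + p * u)) * u * (2 + y) + 21 / 25 * y * ((2 + y) + 2 * (r * (2 + y))) * u\<^sup>2
          + 3 / 20 * (u + p * u) * u * (2 + y) - (p * u)\<^sup>2 * (2 + y) + (p * u) * u * (2 + y) / 50"
        by (simp add: power2_eq_square field_simps)
      also have "\<dots> = - 136 / 100 - 38 / 100 * y + 33 / 100 * y ^ 2 + 19 / 100 * y ^ 3 - 16 / 100 * y ^ 4"
        unfolding pr by (simp add: u_def power2_eq_square power3_eq_cube power4_eq_xxxx field_simps)
      finally show ?thesis
        unfolding w2 unfolding weight_def u_def[symmetric] e .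
    qed
    with N have "(- (y * weight y) + 21 / 25 * y * weight (y / 2) + 3 / 20 * weight y
        - 1 / (1 + y)\<^sup>2 + 1 / 50 / (1 + y)) * ((1 + y)\<^sup>2 * (2 + y)) \<le> 0" by simp
    moreover have "0 < (1 + y)\<^sup>2 * (2 + y)" using assms by auto
    moreover have "a \<le> 0" if "a * b \<le> 0" "0 < b" for a b :: real
      using that by (simp add: mult_le_0_iff)
    ultimately show ?thesis by blast
  qed
  have "h / (1 + y) \<le> 1 / 50 / (1 + y)" using assms by (intro divide_right_mono) auto
  with poly 1 have "- (y * weight y) + 21 / 25 * y * weight (y / 2) + 3 / 20 * weight y
      - (1 - y * h) / ((1 + y) * (1 + y + h)) \<le> 0" by linarith
  then have "h * (- (y * weight y) + 21 / 25 * y * weight (y / 2) + 3 / 20 * weight y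
      - (1 - y * h) / ((1 + y) * (1 + y + h))) \<le> 0"
    using assms by (simp add: mult_le_0_iff)
  then show ?thesis unfolding eq by (simp add: algebra_simps diff_divide_distrib)
qed

text \<open>The seminorm weighted by the larger point shrinks by \<open>1 - 3 / 20 * h\<close> in
  one step: couple the jumps, pull out \<open>sqrt (y - x)\<close>, and feed
  \<open>jump_ratio_bound\<close> into \<open>weight_drift\<close>.\<close>

lemma euler_contract:
  assumes x: "0 \<le> x" "x \<le> y" "y * h \<le> 1" "0 < h" "h \<le> 1 / 50" and L: "0 \<le> L"
    and f: "\<And>a b. 0 \<le> a \<Longrightarrow> a \<le> b \<Longrightarrow> b \<le> y + h \<Longrightarrow> \<bar>f a - f b\<bar> \<le> L * (sqrt (b - a) * weight b)"
  shows "\<bar>euler h f x - euler h f y\<bar> \<le> L * ((1 - 3 / 20 * h) * (sqrt (y - x) * weight y))"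
proof -
  define d where "d = y - x"
  have d: "0 \<le> d" "y = x + d" using x by (auto simp: d_def)
  have xh: "x * h \<le> 1" using mult_right_mono[of x y h] x by linarith
  have y: "0 \<le> y" using x by simp
  have w2: "0 \<le> weight (y / 2)" using weight_bounds(1)[of "y / 2"] y by simp
  \<comment> \<open>The three events of the coupling: no jump, with probability
    \<open>1 - y * h\<close>; both jump, with \<open>x * h\<close>; only the larger position jumps,
    with \<open>d * h\<close>.\<close>
  have "euler h f x - euler h f y = (1 - y * h) * (f (x + h) - f (y + h))
      + h * (x * (f (x / 2 + h) - f (y / 2 + h))) + h * (d * (f (x + h) - f (y / 2 + h)))"
    using x xh y by (simp add: euler_def d_def algebra_simps)
  then have "\<bar>euler h f x - euler h f y\<bar> \<le> \<bar>(1 - y * h) * (f (x + h) - f (y + h))\<bar>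
      + \<bar>h * (x * (f (x / 2 + h) - f (y / 2 + h)))\<bar> + \<bar>h * (d * (f (x + h) - f (y / 2 + h)))\<bar>"
    by linarith
  also have "\<dots> \<le> (1 - y * h) * (L * (sqrt d * weight (y + h)))
      + h * (x * (L * (sqrt (d / 2) * weight (y / 2)))) + h * (d * (L * (sqrt (\<bar>x - d\<bar> / 2) * weight (y / 2))))"
  proof (intro add_mono)
    have "\<bar>f (x + h) - f (y + h)\<bar> \<le> L * (sqrt (y + h - (x + h)) * weight (y + h))"
      using x by (intro f) auto
    then show "\<bar>(1 - y * h) * (f (x + h) - f (y + h))\<bar> \<le> (1 - y * h) * (L * (sqrt d * weight (y + h)))"
      using x by (auto simp: abs_mult d_def intro!: mult_left_mono)
    have "\<bar>f (x / 2 + h) - f (y / 2 + h)\<bar> \<le> L * (sqrt (y / 2 + h - (x / 2 + h)) * weight (y / 2 + h))"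
      using x by (intro f) auto
    also have "y / 2 + h - (x / 2 + h) = d / 2" by (simp add: d_def field_simps)
    also have "L * (sqrt (d / 2) * weight (y / 2 + h)) \<le> L * (sqrt (d / 2) * weight (y / 2))"
      using x y d L weight_antimono[of "y / 2" "y / 2 + h"] by (intro mult_left_mono) auto
    finally show "\<bar>h * (x * (f (x / 2 + h) - f (y / 2 + h)))\<bar>
        \<le> h * (x * (L * (sqrt (d / 2) * weight (y / 2))))"
      using x by (auto simp: abs_mult intro!: mult_left_mono)
    \<comment> \<open>A lone jump may reverse the order, hence the cases. The larger point is at
      least \<open>y / 2\<close> either way, so its weight is at most
      \<open>weight (y / 2)\<close>.\<close>
    have "\<bar>f (x + h) - f (y / 2 + h)\<bar> \<le> L * (sqrt (\<bar>x - d\<bar> / 2) * weight (y / 2))"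
    proof (cases "x \<le> y / 2")
      case True
      have "\<bar>f (x + h) - f (y / 2 + h)\<bar> \<le> L * (sqrt (y / 2 + h - (x + h)) * weight (y / 2 + h))"
        using x True by (intro f) auto
      also have "y / 2 + h - (x + h) = \<bar>x - d\<bar> / 2" using True by (auto simp: d_def)
      also have "L * (sqrt (\<bar>x - d\<bar> / 2) * weight (y / 2 + h)) \<le> L * (sqrt (\<bar>x - d\<bar> / 2) * weight (y / 2))"
        using x y L weight_antimono[of "y / 2" "y / 2 + h"] by (intro mult_left_mono) auto
      finally show ?thesis .
    next
      case False
      have "\<bar>f (y / 2 + h) - f (x + h)\<bar> \<le> L * (sqrt (x + h - (y / 2 + h)) * weight (x + h))"
        using x False by (intro f) auto
      also have "x + h - (y / 2 + h) = \<bar>x - d\<bar> / 2" using False by (auto simp: d_def)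
      also have "L * (sqrt (\<bar>x - d\<bar> / 2) * weight (x + h)) \<le> L * (sqrt (\<bar>x - d\<bar> / 2) * weight (y / 2))"
        using x y L False weight_antimono[of "y / 2" "x + h"] by (intro mult_left_mono) auto
      finally show ?thesis by (simp add: abs_minus_commute)
    qed
    then show "\<bar>h * (d * (f (x + h) - f (y / 2 + h)))\<bar>
        \<le> h * (d * (L * (sqrt (\<bar>x - d\<bar> / 2) * weight (y / 2))))"
      using x d by (auto simp: abs_mult intro!: mult_left_mono)
  qed
  also have "\<dots> = L * ((1 - y * h) * (sqrt d * weight (y + h))
      + h * (x * sqrt (d / 2) + d * sqrt (\<bar>x - d\<bar> / 2)) * weight (y / 2))"
    by (simp add: algebra_simps)
  also have "\<dots> \<le> L * ((1 - y * h) * (sqrt d * weight (y + h))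
      + h * (sqrt d * (21 / 25 * y)) * weight (y / 2))"
  proof -
    have "sqrt (d / 2) = sqrt d * (1 / sqrt 2)" by (simp add: real_sqrt_divide)
    moreover have "d * sqrt (\<bar>x - d\<bar> / 2) = sqrt d * sqrt (d * \<bar>x - d\<bar> / 2)"
    proof -
      have "sqrt (d * \<bar>x - d\<bar> / 2) = sqrt d * sqrt (\<bar>x - d\<bar> / 2)"
        by (simp only: real_sqrt_mult[symmetric] times_divide_eq_right)
      moreover have "d = sqrt d * sqrt d" using d by simp
      ultimately show ?thesis by (metis mult.assoc)
    qed
    ultimately have "x * sqrt (d / 2) + d * sqrt (\<bar>x - d\<bar> / 2)
        = sqrt d * (x / sqrt 2 + sqrt (d * \<bar>x - d\<bar> / 2))"
      by (simp add: distrib_left mult.left_commute)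
    also have "\<dots> \<le> sqrt d * (21 / 25 * y)"
      using jump_ratio_bound[OF x(1) d(1)] d by (intro mult_left_mono) auto
    finally show ?thesis
      using L x w2 by (intro mult_left_mono add_left_mono mult_right_mono) auto
  qed
  also have "\<dots> = L * (sqrt d * ((1 - y * h) * weight (y + h) + h * (21 / 25 * y) * weight (y / 2)))"
    by (simp add: algebra_simps)
  also have "\<dots> \<le> L * (sqrt d * ((1 - 3 / 20 * h) * weight y))"
    using weight_drift[of y h] x y L d by (intro mult_left_mono) auto
  finally show ?thesis by (simp add: d_def mult_ac)
qed

text \<open>A step raises the position by at most \<open>h\<close>, so the budget
  \<open>y + k * h \<le> K\<close> keeps every jump probability below \<open>1\<close> throughout
  the induction.\<close>

lemma euler_iter_contract:
  assumes h: "0 < h" "h \<le> 1 / 50" "K * h \<le> 1" and L: "0 \<le> L"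
    and f: "\<And>a b. 0 \<le> a \<Longrightarrow> a \<le> b \<Longrightarrow> \<bar>f a - f b\<bar> \<le> L * sqrt (b - a)"
    and x: "0 \<le> x" "x \<le> y" "y + k * h \<le> K"
  shows "\<bar>(euler h ^^ k) f x - (euler h ^^ k) f y\<bar>
    \<le> L * (1 - 3 / 20 * h) ^ k * (sqrt (y - x) * weight y)"
  using x
proof (induction k arbitrary: x y)
  case 0
  have "\<bar>f x - f y\<bar> \<le> L * (sqrt (y - x) * 1)" using f 0 by simp
  also have "\<dots> \<le> L * (sqrt (y - x) * weight y)"
    using 0 L weight_bounds(1)[of y] by (intro mult_left_mono) auto
  finally show ?case by simp
next
  case (Suc k)
  have k: "0 \<le> k * h" using h by simp
  have "y + (k * h + h) \<le> K" using Suc.prems by (simp add: algebra_simps)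
  then have "y \<le> K" using k h by linarith
  then have "y * h \<le> K * h" using h by (intro mult_right_mono) auto
  then have yh: "y * h \<le> 1" using h(3) by linarith
  have "\<bar>euler h ((euler h ^^ k) f) x - euler h ((euler h ^^ k) f) y\<bar>
      \<le> L * (1 - 3 / 20 * h) ^ k * ((1 - 3 / 20 * h) * (sqrt (y - x) * weight y))"
  proof (rule euler_contract)
    show "0 \<le> L * (1 - 3 / 20 * h) ^ k" using L h by simp
    fix a b :: real assume "0 \<le> a" "a \<le> b" "b \<le> y + h"
    then show "\<bar>(euler h ^^ k) f a - (euler h ^^ k) f b\<bar>
        \<le> L * (1 - 3 / 20 * h) ^ k * (sqrt (b - a) * weight b)"
      using Suc.prems by (intro Suc.IH) (auto simp: algebra_simps)
  qed (use Suc.prems h yh in auto)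
  then show ?case by (simp add: mult_ac)
qed

subsection \<open>Convergence of the Euler scheme\<close>

text \<open>Local errors add up because \<open>tcp_op h\<close> does not enlarge sup bounds. The
  local estimate needs a Hoelder constant for the iterates uniform in \<open>k\<close>: by
  contraction it is at most \<open>2 * H\<close>, which turns the factor \<open>3\<close> into
  \<open>6\<close>.\<close>

lemma euler_error:
  assumes f: "f \<in> borel_measurable borel" and bd: "\<And>x. \<bar>f x\<bar> \<le> B"
    and h: "0 < h" "h \<le> 1 / 50" "K * h \<le> 1" and K: "1 \<le> K" and H: "0 \<le> H"
    and hoelder: "\<And>a b. 0 \<le> a \<Longrightarrow> a \<le> b \<Longrightarrow> \<bar>f a - f b\<bar> \<le> H * sqrt (b - a)"
    and x: "0 \<le> x" "x + k * h \<le> K"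
  shows "\<bar>tcp_op (k * h) f x - (euler h ^^ k) f x\<bar> \<le> k * (6 * K ^ 3 * H * (h * sqrt h))"
  using x
proof (induction k arbitrary: x)
  case 0
  have "\<bar>tcp_op 0 f x - f (x + 0)\<bar> \<le> 2 * B * (1 - exp (- hazard x 0))"
  proof (rule tcp_op_flow[OF f bd])
    show "\<bar>f a - f (x + 0)\<bar> \<le> 2 * B" for a using bd[of a] bd[of "x + 0"] by linarith
  qed (use 0 in auto)
  then show ?case by simp
next
  case (Suc k)
  let ?g = "(euler h ^^ k) f" and ?u = "tcp_op (k * h) f" and ?\<epsilon> = "6 * K ^ 3 * H * (h * sqrt h)"
  have xk: "x + h + k * h \<le> K" using Suc.prems by (simp add: algebra_simps)
  have kh: "0 \<le> k * h" using h by simp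
  have xh: "x + h \<le> K" using xk kh by linarith
  have g: "?g \<in> borel_measurable borel" "\<bar>?g y\<bar> \<le> B" for y
    using euler_iter_measurable[OF f] euler_iter_bound[of f, OF bd] by auto
  have u: "?u \<in> borel_measurable borel" "\<bar>?u y\<bar> \<le> B" for y
    using tcp_op_bound[of f, OF bd] f by auto
  have "tcp_op (Suc k * h) f x = tcp_op h ?u x"
    using tcp_op_semigroup[OF f bd, of x h "k * h"] Suc.prems h kh by (simp add: algebra_simps)
  then have "tcp_op (Suc k * h) f x - (euler h ^^ Suc k) f x
      = tcp_op h (\<lambda>y. ?u y - ?g y) x + (tcp_op h ?g x - euler h ?g x)"
    using tcp_op_diff[OF u(1) g(1), of B B h x] u(2) g(2) by simp
  moreover have "\<bar>tcp_op h (\<lambda>y. ?u y - ?g y) x - 0\<bar> \<le> k * ?\<epsilon>"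
  proof (rule tcp_op_near[where B = "2 * B"])
    show "\<bar>?u y - ?g y\<bar> \<le> 2 * B" for y using u(2)[of y] g(2)[of y] by linarith
    show "\<bar>?u a - ?g a - 0\<bar> \<le> k * ?\<epsilon>" if "0 \<le> a" "a \<le> x + h" for a
      using Suc.IH[of a] that xk by simp
  qed (use Suc.prems h g(1) u(1) in auto)
  moreover have "\<bar>tcp_op h ?g x - euler h ?g x\<bar> \<le> 3 * K ^ 3 * (2 * H) * (h * sqrt h)"
  proof (rule tcp_op_euler_step[OF g])
    have "x \<le> K" using xk kh h by linarith
    then have "x * h \<le> K * h" using h by (intro mult_right_mono) auto
    then show "x * h \<le> 1" using h(3) by linarith
    fix a b :: real assume ab: "0 \<le> a" "a \<le> b" "b \<le> x + h"
    have "\<bar>?g a - ?g b\<bar> \<le> H * (1 - 3 / 20 * h) ^ k * (sqrt (b - a) * weight b)"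
      by (rule euler_iter_contract[OF h H hoelder]) (use ab xk in auto)
    also have "\<dots> \<le> H * 1 * (sqrt (b - a) * 2)"
      using H h ab weight_bounds[of b] by (intro mult_mono mult_left_mono power_le_one) auto
    finally show "\<bar>?g a - ?g b\<bar> \<le> 2 * H * sqrt (b - a)" by simp
  qed (use Suc.prems h K H xh in auto)
  ultimately have "\<bar>tcp_op (Suc k * h) f x - (euler h ^^ Suc k) f x\<bar> \<le> k * ?\<epsilon> + ?\<epsilon>"
    by (auto simp: abs_le_iff)
  then show ?case by (simp add: algebra_simps)
qed

lemma euler_tendsto:
  assumes f: "f \<in> borel_measurable borel" and bd: "\<And>x. \<bar>f x\<bar> \<le> B" and H: "0 \<le> H"
    and hoelder: "\<And>a b. 0 \<le> a \<Longrightarrow> a \<le> b \<Longrightarrow> \<bar>f a - f b\<bar> \<le> H * sqrt (b - a)"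
    and x: "0 \<le> x" and t: "0 < t"
  shows "(\<lambda>n. (euler (t / n) ^^ n) f x) \<longlonglongrightarrow> tcp_op t f x"
proof (rule Lim_transform)
  define K where "K = x + t + 1"
  show "(\<lambda>n. tcp_op t f x) \<longlonglongrightarrow> tcp_op t f x" by simp
  have c50: "0 < (1 / 50 :: real)" and cK: "0 < 1 / K" using x t by (auto simp: K_def)
  have small: "\<forall>\<^sub>F n in sequentially. t / real n < c" if "0 < c" for c
    using that by (intro order_tendstoD(2)[OF lim_const_over_n]) auto
  have "\<forall>\<^sub>F n in sequentially. norm ((euler (t / n) ^^ n) f x - tcp_op t f x)
      \<le> 6 * K ^ 3 * H * t * sqrt (t / n)"
    using eventually_gt_at_top[of 0] small[OF c50] small[OF cK]
  proof (eventually_elim)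
    case (elim n)
    have K: "1 \<le> K" using x t by (simp add: K_def)
    have n: "n * (t / n) = t" using elim by simp
    have "\<bar>tcp_op (n * (t / n)) f x - (euler (t / n) ^^ n) f x\<bar>
        \<le> n * (6 * K ^ 3 * H * (t / n * sqrt (t / n)))"
      by (rule euler_error[OF f bd])
        (use elim t H hoelder x K n in \<open>auto simp: K_def field_simps\<close>)
    also have "\<dots> = 6 * K ^ 3 * H * (n * (t / n)) * sqrt (t / n)" by (simp only: mult_ac)
    finally show ?case by (simp only: n real_norm_def abs_minus_commute)
  qed
  moreover have "(\<lambda>n. 6 * K ^ 3 * H * t * sqrt (t / real n)) \<longlonglongrightarrow> 6 * K ^ 3 * H * t * sqrt 0"
    by (intro tendsto_intros lim_const_over_n)
  then have "(\<lambda>n. 6 * K ^ 3 * H * t * sqrt (t / real n)) \<longlonglongrightarrow> 0" by simp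
  ultimately show "(\<lambda>n. (euler (t / n) ^^ n) f x - tcp_op t f x) \<longlonglongrightarrow> 0"
    by (rule Lim_null_comparison)
qed

text \<open>The contraction of the scheme passes to the limit through
  \<open>(1 - 3 / 20 * (t / n)) ^ n \<le> exp (- (3 / 20 * t))\<close>; removing the weight, which
  lies between \<open>1\<close> and \<open>2\<close>, costs the factor \<open>2\<close>.\<close>

lemma tcp_op_contract:
  assumes f: "f \<in> borel_measurable borel" and bd: "\<And>x. \<bar>f x\<bar> \<le> B" and H: "0 \<le> H"
    and hoelder: "\<And>a b. 0 \<le> a \<Longrightarrow> a \<le> b \<Longrightarrow> \<bar>f a - f b\<bar> \<le> H * sqrt (b - a)"
    and x: "0 \<le> x" "x \<le> y" and t: "0 < t"
  shows "\<bar>tcp_op t f x - tcp_op t f y\<bar> \<le> 2 * H * exp (- (3 / 20 * t)) * sqrt (y - x)"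
proof (rule LIMSEQ_le_const2)
  define K where "K = y + t + 1"
  have y: "0 \<le> y" using x by simp
  show "(\<lambda>n. \<bar>(euler (t / n) ^^ n) f x - (euler (t / n) ^^ n) f y\<bar>) \<longlonglongrightarrow> \<bar>tcp_op t f x - tcp_op t f y\<bar>"
    by (intro tendsto_intros euler_tendsto[OF f bd H hoelder]) (use x y t in auto)
  have c50: "0 < (1 / 50 :: real)" and cK: "0 < 1 / K" using x t by (auto simp: K_def)
  have small: "\<forall>\<^sub>F n in sequentially. t / real n < c" if "0 < c" for c
    using that by (intro order_tendstoD(2)[OF lim_const_over_n]) auto
  have "\<forall>\<^sub>F n in sequentially. \<bar>(euler (t / n) ^^ n) f x - (euler (t / n) ^^ n) f y\<bar>
      \<le> 2 * H * exp (- (3 / 20 * t)) * sqrt (y - x)"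
    using eventually_gt_at_top[of 0] small[OF c50] small[OF cK]
  proof (eventually_elim)
    case (elim n)
    have n: "n * (t / n) = t" using elim by simp
    have "\<bar>(euler (t / n) ^^ n) f x - (euler (t / n) ^^ n) f y\<bar>
        \<le> H * (1 - 3 / 20 * (t / n)) ^ n * (sqrt (y - x) * weight y)"
      by (rule euler_iter_contract[where K = K])
        (use elim t H hoelder x y n in \<open>auto simp: K_def field_simps\<close>)
    also have "\<dots> \<le> H * exp (- (3 / 20 * t)) * (sqrt (y - x) * 2)"
    proof (intro mult_mono)
      have "(1 - 3 / 20 * (t / n)) ^ n \<le> exp (- (3 / 20 * (t / n))) ^ n"
        using elim exp_ge_add_one_self[of "- (3 / 20 * (t / n))"] by (intro power_mono) auto
      also have "\<dots> = exp (- (3 / 20 * (n * (t / n))))"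
        by (simp add: exp_of_nat_mult[symmetric] mult_ac)
      finally show "(1 - 3 / 20 * (t / n)) ^ n \<le> exp (- (3 / 20 * t))" by (simp only: n)
      show "0 \<le> (1 - 3 / 20 * (t / n)) ^ n" using elim by (intro zero_le_power) auto
    qed (use H x y weight_bounds[of y] in auto)
    finally show ?case by (simp add: mult_ac)
  qed
  then show "\<exists>N. \<forall>n\<ge>N. \<bar>(euler (t / n) ^^ n) f x - (euler (t / n) ^^ n) f y\<bar>
      \<le> 2 * H * exp (- (3 / 20 * t)) * sqrt (y - x)"
    by (simp add: eventually_sequentially)
qed

subsection \<open>Coming down from infinity\<close>

lemma euler_affine_le:
  assumes x: "0 \<le> x" "x * h \<le> 1" "0 \<le> h"
    and f: "\<And>z. 0 \<le> z \<Longrightarrow> z \<le> x + h \<Longrightarrow> f z \<le> \<alpha> + \<beta> * z"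
  shows "euler h f x \<le> \<alpha> + \<beta> * (x + h) - \<beta> * h * x\<^sup>2 / 2"
proof -
  have "euler h f x = (1 - x * h) * f (x + h) + x * h * f (x / 2 + h)"
    using x by (simp add: euler_def)
  also have "\<dots> \<le> (1 - x * h) * (\<alpha> + \<beta> * (x + h)) + x * h * (\<alpha> + \<beta> * (x / 2 + h))"
    using x by (intro add_mono mult_left_mono f) auto
  also have "\<dots> = \<alpha> + \<beta> * (x + h) - \<beta> * h * x\<^sup>2 / 2"
    by (simp add: power2_eq_square field_simps)
  finally show ?thesis .
qed

text \<open>The generator gives \<open>L x = 1 - x\<^sup>2 / 2\<close>; bounding \<open>x\<^sup>2\<close> below by time-dependent tangents
  makes the affine functions \<open>3 t + (1 - t)\<^sup>2 x\<close> supersolutions, whose slope vanishes at time 1.\<close>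

lemma euler_iter_affine_le:
  assumes h: "0 < h" "K * h \<le> 1" "real n * h = 1" and f: "\<And>z. 0 \<le> z \<Longrightarrow> f z \<le> z"
    and x: "0 \<le> x" "x + k * h \<le> K" and "k \<le> n"
  shows "(euler h ^^ k) f x \<le> 3 * h * k + (1 - k * h)\<^sup>2 * x"
  using x \<open>k \<le> n\<close>
proof (induction k arbitrary: x)
  case 0
  then show ?case by (simp add: f)
next
  case (Suc k)
  define b where "b = 1 - k * h"
  have kh: "0 \<le> k * h" "x + k * h + h \<le> K" using h Suc.prems by (auto simp: algebra_simps)
  have "x \<le> K" using kh h by linarith
  then have "x * h \<le> K * h" using h by (intro mult_right_mono) auto
  then have xh: "x * h \<le> 1" using h by linarith
  have "real k * h \<le> n * h" using h Suc.prems by (intro mult_right_mono) auto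
  then have b: "0 \<le> b" "b \<le> 1" using h kh by (auto simp: b_def)
  have "euler h ((euler h ^^ k) f) x \<le> 3 * h * k + b\<^sup>2 * (x + h) - b\<^sup>2 * h * x\<^sup>2 / 2"
    by (rule euler_affine_le) (use Suc xh h kh in \<open>auto simp: b_def intro!: Suc.IH\<close>)
  also have "\<dots> \<le> 3 * h * Suc k + (b - h)\<^sup>2 * x"
  proof -
    have "b\<^sup>2 \<le> 1" using b by (simp add: power_le_one)
    then have "h * b\<^sup>2 \<le> h * 1" using h by (intro mult_left_mono) auto
    \<comment> \<open>The tangent inequality \<open>b\<^sup>2 x\<^sup>2 \<ge> 4 b x - 4\<close>
      turns the quadratic loss into \<open>- 2 b h x + 2 h\<close>. With the drift
      \<open>b\<^sup>2 h \<le> h\<close> this gives the increment \<open>3 * h\<close>, and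
      \<open>b\<^sup>2 - 2 b h \<le> (b - h)\<^sup>2\<close>.\<close>
    moreover have "0 \<le> h * (b * x - 2)\<^sup>2" "0 \<le> h\<^sup>2 * x" using h Suc.prems by auto
    ultimately show ?thesis by (simp add: power2_eq_square algebra_simps)
  qed
  also have "b - h = 1 - Suc k * h" by (simp add: b_def algebra_simps)
  finally show ?case by simp
qed

text \<open>The difference is at most \<open>B\<close> and at most \<open>b - a\<close>, hence at
  most their geometric mean. This makes the truncated identity admissible in
  \<open>euler_tendsto\<close>.\<close>

lemma abs_clip_diff_le:
  fixes a b B :: real
  assumes "0 \<le> a" "a \<le> b" "0 \<le> B"
  shows "\<bar>max 0 (min a B) - max 0 (min b B)\<bar> \<le> sqrt B * sqrt (b - a)"
proof -
  let ?d = "\<bar>max 0 (min a B) - max 0 (min b B)\<bar>"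
  have "?d \<le> B" "?d \<le> b - a" using assms by (auto simp: min_def max_def)
  then have "?d * ?d \<le> B * (b - a)" using assms by (intro mult_mono) auto
  then have "?d \<le> sqrt (B * (b - a))" by (intro real_le_rsqrt) (simp add: power2_eq_square)
  then show ?thesis by (simp add: real_sqrt_mult)
qed

text \<open>Truncation supplies the boundedness and regularity required by the limit; the bound
  depends neither on \<open>B\<close> nor on \<open>x\<close>.\<close>

lemma tcp_op_truncated_mean:
  assumes "0 \<le> x" "0 \<le> B"
  shows "tcp_op 1 (\<lambda>x. max 0 (min x B)) x \<le> 3"
proof (rule LIMSEQ_le_const2)
  let ?f = "\<lambda>x. max 0 (min x B)"
  show "(\<lambda>n. (euler (1 / n) ^^ n) ?f x) \<longlonglongrightarrow> tcp_op 1 ?f x"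
    by (rule euler_tendsto[where B = B, OF _ _ _ abs_clip_diff_le]) (use assms in auto)
  define N where "N = nat \<lceil>x + 2\<rceil>"
  have "(euler (1 / n) ^^ n) ?f x \<le> 3" if "N \<le> n" for n
  proof -
    have n: "x + 2 \<le> real n" using that unfolding N_def by linarith
    then have n0: "0 < n" using assms by (intro gr0I) auto
    have "(euler (1 / n) ^^ n) ?f x \<le> 3 * (1 / n) * n + (1 - n * (1 / n))\<^sup>2 * x"
      by (rule euler_iter_affine_le[where K = "x + 1" and n = n])
        (use n n0 assms in \<open>auto simp: field_simps\<close>)
    also have "\<dots> = 3" using n0 by simp
    finally show ?thesis .
  qed
  then show "\<exists>N. \<forall>n\<ge>N. (euler (1 / n) ^^ n) ?f x \<le> 3" by blast
qed

subsection \<open>Smoothing by the first jump\<close>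

text \<open>\<open>tcp_op t f x\<close> without its no-jump term
  \<open>exp (- hazard x t) * f (x + t)\<close>, the only term through which irregularity of
  \<open>f\<close> survives.\<close>

definition jump_part :: "real \<Rightarrow> (real \<Rightarrow> real) \<Rightarrow> real \<Rightarrow> real" where
  "jump_part t f x = first_jump x t (\<lambda>w. tcp_op (t - w) f ((x + w) / 2))"

lemma one_minus_exp_hazard_le:
  "1 - exp (- hazard x t) \<le> (x + t) * t"
  using exp_ge_add_one_self[of "- hazard x t"] hazard_le_mult[of x t] by linarith

text \<open>The shift changes the rate factor by \<open>2 * d\<close>, giving the first error term,
  and raises the hazard by \<eta>, giving the second.\<close>

lemma jump_density_shift:
  assumes "0 \<le> x" "0 \<le> d" "d \<le> 1" "0 \<le> w"
  shows "\<bar>jump_density (x + d) (d + w) - jump_density x w\<bar>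
    \<le> 2 * d + jump_density x w * (d * (x + 2 * w + 2))"
proof -
  define \<eta> where "\<eta> = d * (x + 2 * w) + 3 / 2 * d\<^sup>2"
  have \<eta>: "0 \<le> \<eta>" "\<eta> \<le> d * (x + 2 * w + 2)"
  proof -
    show "0 \<le> \<eta>" using assms by (simp add: \<eta>_def)
    have "d * d \<le> d * 1" using assms by (intro mult_left_mono) auto
    then show "\<eta> \<le> d * (x + 2 * w + 2)" using assms by (simp add: \<eta>_def power2_eq_square distrib_left)
  qed
  have hz: "hazard (x + d) (d + w) = hazard x w + \<eta>"
    by (simp add: hazard_def \<eta>_def power2_eq_square field_simps)
  have "jump_density (x + d) (d + w) - jump_density x w
      = 2 * d * exp (- hazard (x + d) (d + w)) - jump_density x w * (1 - exp (- \<eta>))"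
  proof -
    have "exp (- (hazard x w + \<eta>)) = exp (- hazard x w) * exp (- \<eta>)"
      by (simp add: exp_add[symmetric])
    then show ?thesis unfolding jump_density_def hz by (simp add: algebra_simps)
  qed
  also have "\<bar>\<dots>\<bar> \<le> \<bar>2 * d * exp (- hazard (x + d) (d + w))\<bar> + \<bar>jump_density x w * (1 - exp (- \<eta>))\<bar>"
    by (rule abs_triangle_ineq4)
  also have "\<dots> \<le> 2 * d + jump_density x w * (d * (x + 2 * w + 2))"
  proof (rule add_mono)
    show "\<bar>2 * d * exp (- hazard (x + d) (d + w))\<bar> \<le> 2 * d"
      using assms hazard_nonneg[of "x + d" "d + w"] by (simp add: abs_mult mult_left_le)
    have "1 - exp (- \<eta>) \<le> d * (x + 2 * w + 2)"
      using exp_ge_add_one_self[of "- \<eta>"] \<eta> by linarith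
    then show "\<bar>jump_density x w * (1 - exp (- \<eta>))\<bar> \<le> jump_density x w * (d * (x + 2 * w + 2))"
      using \<eta> jump_density_nonneg[of x w] assms by (simp add: abs_mult mult_left_mono)
  qed
  finally show ?thesis .
qed

lemma tcp_op_01:
  assumes f: "f \<in> borel_measurable borel" and f01: "\<And>x. 0 \<le> f x" "\<And>x. f x \<le> 1"
    and "0 \<le> s" "0 \<le> x"
  shows "0 \<le> tcp_op s f x" "tcp_op s f x \<le> 1"
proof -
  have bd: "\<bar>f z\<bar> \<le> 1" for z using f01[of z] by simp
  have "\<bar>tcp_op s f x - 1 / 2\<bar> \<le> 1 / 2"
  proof (rule tcp_op_near[OF f bd assms(5,4)])
    show "\<bar>f a - 1 / 2\<bar> \<le> 1 / 2" for a using f01[of a] by linarith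
  qed
  then show "0 \<le> tcp_op s f x" "tcp_op s f x \<le> 1" by linarith+
qed

lemma jump_part_01:
  assumes f [measurable]: "f \<in> borel_measurable borel" and f01: "\<And>x. 0 \<le> f x" "\<And>x. f x \<le> 1"
    and x: "0 \<le> x" "0 \<le> t"
  shows "0 \<le> jump_part t f x" "jump_part t f x \<le> 1"
proof -
  have bd: "\<bar>tcp_op s f z\<bar> \<le> 1" for s z
    by (rule tcp_op_bound) (use f01 in \<open>simp\<close>)
  have "first_jump x t (\<lambda>_. 0) \<le> jump_part t f x"
    unfolding jump_part_def
    by (rule first_jump_mono[where B = 0 and B' = 1]) (use x f01 in \<open>auto intro!: tcp_op_01 simp: bd\<close>)
  then show "0 \<le> jump_part t f x" using x by (simp add: first_jump_const)
  have "\<bar>jump_part t f x\<bar> \<le> 1 * (1 - exp (- hazard x t))"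
    unfolding jump_part_def by (rule first_jump_bound) (use x bd in auto)
  then show "jump_part t f x \<le> 1" by (smt (verit) exp_gt_zero)
qed

text \<open>A trajectory from \<open>x\<close> jumping at time \<open>w\<close> and one from \<open>x + d\<close> jumping at time \<open>w + d\<close>
  are on the same line \<open>position - time\<close> afterwards; comparing them gives a Lipschitz bound.\<close>

lemma jump_part_lipschitz:
  assumes f [measurable]: "f \<in> borel_measurable borel" and f01: "\<And>x. 0 \<le> f x" "\<And>x. f x \<le> 1"
    and x: "0 \<le> x" "x \<le> y" and t: "1 \<le> t"
  shows "\<bar>jump_part t f x - jump_part t f y\<bar> \<le> 8 * (1 + y + t) * (y - x)"
proof -
  have bd: "\<bar>f z\<bar> \<le> 1" for z using f01[of z] by simp
  have bd': "\<bar>tcp_op s f z\<bar> \<le> 1" for s z by (rule tcp_op_bound) (rule bd)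
  note op01 = tcp_op_01[OF f f01] and jp = jump_part_01[OF f f01 _ order_trans[OF zero_le_one t]]
  show ?thesis
  proof (cases "y - x \<le> 1")
    case False
    have "\<bar>jump_part t f x - jump_part t f y\<bar> \<le> 1" using jp[of x] jp[of y] x by (simp add: abs_le_iff)
    also have "\<dots> \<le> 8 * (1 + y + t) * (y - x)"
      using mult_mono[of 1 "8 * (1 + y + t)" 1 "y - x"] False x t by simp
    finally show ?thesis .
  next
    case True
    define d where "d = y - x"
    define T where "T = t - d"
    have d: "0 \<le> d" "d \<le> 1" "y = x + d" and T: "0 \<le> T" "T \<le> t" "t = T + d" "t = d + T"
      using x t True by (auto simp: d_def T_def)
    let ?Gx = "\<lambda>w. tcp_op (t - w) f ((x + w) / 2)" and ?Gy = "\<lambda>w. tcp_op (t - w) f ((y + w) / 2)"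
    let ?E = "exp (- hazard y d)"
    have Gx [measurable]: "?Gx \<in> borel_measurable borel" and Gy [measurable]: "?Gy \<in> borel_measurable borel"
      by measurable
    \<comment> \<open>Pairing jump time \<open>w\<close> from \<open>x\<close> with
      \<open>d + w\<close> from \<open>y\<close> leaves two unpaired spans of length
      \<open>d\<close>: the last one for \<open>x\<close> and the first one for \<open>y\<close>.
      Each has jump probability of order \<open>d\<close>.\<close>
    have 1: "jump_part t f x = first_jump x T ?Gx + exp (- hazard x T) * first_jump (x + T) d (\<lambda>w. ?Gx (T + w))"
      unfolding jump_part_def by (subst T(3), rule first_jump_add[OF Gx bd']) (use x T d in auto)
    have 2: "jump_part t f y = first_jump y d ?Gy + ?E * first_jump (y + d) T (\<lambda>w. ?Gy (d + w))"
      unfolding jump_part_def by (subst T(4), rule first_jump_add[OF Gy bd']) (use x T d in auto)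
    have 3: "\<bar>first_jump y d ?Gy\<bar> \<le> (y + 1) * d"
    proof -
      have "\<bar>first_jump y d ?Gy\<bar> \<le> 1 * (1 - exp (- hazard y d))"
        by (rule first_jump_bound) (use x d bd' in auto)
      also have "\<dots> \<le> (y + d) * d" using one_minus_exp_hazard_le by simp
      also have "\<dots> \<le> (y + 1) * d" using d by (intro mult_right_mono) auto
      finally show ?thesis .
    qed
    have 4: "\<bar>exp (- hazard x T) * first_jump (x + T) d (\<lambda>w. ?Gx (T + w))\<bar> \<le> (x + t) * d"
    proof -
      have "\<bar>exp (- hazard x T) * first_jump (x + T) d (\<lambda>w. ?Gx (T + w))\<bar>
          \<le> 1 * \<bar>first_jump (x + T) d (\<lambda>w. ?Gx (T + w))\<bar>"
        unfolding abs_mult using hazard_nonneg[of x T] x T by (intro mult_right_mono) auto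
      also have "\<bar>first_jump (x + T) d (\<lambda>w. ?Gx (T + w))\<bar> \<le> 1 * (1 - exp (- hazard (x + T) d))"
        by (rule first_jump_bound) (use x d T bd' in auto)
      also have "1 - exp (- hazard (x + T) d) \<le> (x + t) * d"
        using one_minus_exp_hazard_le[of "x + T" d] by (simp only: T(3) add.assoc)
      finally show ?thesis by simp
    qed
    define c where "c = d * (5 / 2 * x + 7 / 2 * t + 3)"
    have 5: "\<bar>first_jump x T ?Gx - ?E * first_jump (y + d) T (\<lambda>w. ?Gy (d + w))\<bar> \<le> 2 * d * t + c"
    proof -
      let ?a = "\<lambda>w. indicator {0..T} w * (jump_density x w * ?Gx w)"
      let ?b = "\<lambda>w. indicator {0..T} w * (jump_density (y + d) w * ?Gy (d + w))"
      let ?m = "\<lambda>w. 2 * d * indicator {0..T} w + c * (jump_density x w * indicator {0..T} w)"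
      have a: "integrable lborel ?a"
        by (rule first_jump_integrable[OF Gx]) (use x bd' in auto)
      have b: "integrable lborel ?b"
        by (rule first_jump_integrable[where B = 1]) (use x d bd' in auto)
      have c: "0 \<le> c" using d x t by (simp add: c_def)
      have jd: "has_bochner_integral lborel (\<lambda>w. jump_density x w * indicator {0..T} w) (1 - exp (- hazard x T))"
        using has_bochner_integral_jump_density[OF T(1), of x] by simp
      have m: "has_bochner_integral lborel ?m (2 * d * T + c * (1 - exp (- hazard x T)))"
        using T(1) by (intro has_bochner_integral_add has_bochner_integral_mult_right jd)
          (auto simp: has_bochner_integral_iff emeasure_lborel_Icc_eq)
      have diff: "first_jump x T ?Gx - ?E * first_jump (y + d) T (\<lambda>w. ?Gy (d + w)) = (\<integral>w. ?a w - ?E * ?b w \<partial>lborel)"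
        unfolding first_jump_def
        by (subst Bochner_Integration.integral_diff) (auto intro!: a b integrable_mult_right simp: integral_mult_right_zero)
      have "\<bar>\<integral>w. ?a w - ?E * ?b w \<partial>lborel\<bar> \<le> (\<integral>w. ?m w \<partial>lborel)"
      proof (rule order_trans[OF integral_abs_bound integral_mono])
        show "integrable lborel (\<lambda>w. \<bar>?a w - ?E * ?b w\<bar>)"
          by (intro integrable_abs Bochner_Integration.integrable_diff integrable_mult_right a b)
        show "integrable lborel ?m" using m by (simp add: has_bochner_integral_iff)
        show "\<bar>?a w - ?E * ?b w\<bar> \<le> ?m w" for w
        proof (cases "w \<in> {0..T}")
          case True
          then have w: "0 \<le> w" "w \<le> T" by auto
          let ?z = "(x + w) / 2"
          let ?k' = "tcp_op (T - w) f (?z + d)"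
          have k': "?Gy (d + w) = ?k'" by (simp add: T_def d(3) field_simps)
          have E: "?E * jump_density (y + d) w = jump_density y (d + w)" by (simp add: jump_density_add)
          have jd0: "0 \<le> jump_density x w" using x w by (intro jump_density_nonneg)
          have kk: "\<bar>?Gx w - ?k'\<bar> \<le> d * ((x + t) / 2 + 1)"
          proof -
            \<comment> \<open>After its jump the path from \<open>x\<close> has \<open>d\<close>
              more time left than its partner; flowing for that time takes it to the partner's
              position \<open>?z + d\<close>, unless it jumps again.\<close>
            have "?Gx w = tcp_op d (tcp_op (T - w) f) ?z"
              using tcp_op_semigroup[OF f bd, of ?z d "T - w"] x w d T by (simp add: add_diff_eq)
            also have "\<bar>\<dots> - ?k'\<bar> \<le> 1 * (1 - exp (- hazard ?z d))"
            proof (rule tcp_op_flow[where B = 1])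
              show "\<bar>tcp_op (T - w) f a - tcp_op (T - w) f (?z + d)\<bar> \<le> 1" if "0 \<le> a" for a
                using op01[of "T - w" a] op01[of "T - w" "?z + d"] that w x d by (simp add: abs_le_iff)
            qed (use x w d bd' in auto)
            also have "\<dots> \<le> (?z + d) * d" using one_minus_exp_hazard_le by simp
            also have "\<dots> \<le> ((x + t) / 2 + 1) * d" using w d T by (intro mult_right_mono add_mono) auto
            finally show ?thesis by (simp add: mult.commute)
          qed
          have "?a w - ?E * ?b w = jump_density x w * ?Gx w - (?E * jump_density (y + d) w) * ?k'"
            using True k' by simp
          then have eq: "?a w - ?E * ?b w = jump_density x w * (?Gx w - ?k') - (jump_density y (d + w) - jump_density x w) * ?k'"
            unfolding E by (simp add: algebra_simps)
          have "\<bar>?a w - ?E * ?b w\<bar>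
              \<le> jump_density x w * (d * ((x + t) / 2 + 1)) + (2 * d + jump_density x w * (d * (x + 2 * w + 2))) * 1"
            unfolding eq
          proof (rule order_trans[OF abs_triangle_ineq4 add_mono])
            show "\<bar>jump_density x w * (?Gx w - ?k')\<bar> \<le> jump_density x w * (d * ((x + t) / 2 + 1))"
              unfolding abs_mult using jd0 kk by (intro mult_mono) auto
            show "\<bar>(jump_density y (d + w) - jump_density x w) * ?k'\<bar>
                \<le> (2 * d + jump_density x w * (d * (x + 2 * w + 2))) * 1"
              unfolding abs_mult d(3) using jd0 x d w
              by (intro mult_mono jump_density_shift bd') auto
          qed
          also have "\<dots> = 2 * d + (d * ((x + t) / 2 + 1 + (x + 2 * w + 2))) * jump_density x w"
            by (simp add: algebra_simps)
          also have "\<dots> \<le> 2 * d + c * jump_density x w"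
            unfolding c_def using w T d x t jd0
            by (intro add_left_mono mult_right_mono mult_left_mono) (auto simp: field_simps)
          finally show ?thesis using True by simp
        qed simp
      qed
      moreover have "(\<integral>w. ?m w \<partial>lborel) = 2 * d * T + c * (1 - exp (- hazard x T))"
        using m by (rule has_bochner_integral_integral_eq)
      moreover have "2 * d * T + c * (1 - exp (- hazard x T)) \<le> 2 * d * t + c * 1"
        using T d c by (intro add_mono mult_left_mono) auto
      ultimately show ?thesis unfolding diff by linarith
    qed
    have "\<bar>jump_part t f x - jump_part t f y\<bar> \<le> (x + t) * d + (y + 1) * d + (2 * d * t + c)"
      unfolding 1 2 using 3 4 5 by linarith
    also have "\<dots> = d * (7 / 2 * x + y + 13 / 2 * t + 4)" by (simp add: c_def field_simps)
    also have "\<dots> \<le> d * (8 * (1 + y + t))" using d x t by (intro mult_left_mono) auto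
    finally show ?thesis by (simp add: d_def mult_ac)
  qed
qed

subsection \<open>Maximal coupling\<close>

definition add_measure :: "'a measure \<Rightarrow> 'a measure \<Rightarrow> 'a measure" where
  "add_measure M N = measure_of (space M) (sets M) (\<lambda>A. emeasure M A + emeasure N A)"

lemma sets_add_measure [simp, measurable_cong]: "sets (add_measure M N) = sets M"
  by (simp add: add_measure_def)

lemma space_add_measure [simp]: "space (add_measure M N) = space M"
  by (simp add: add_measure_def)

lemma emeasure_add_measure:
  assumes N: "sets N = sets M" and "A \<in> sets M"
  shows "emeasure (add_measure M N) A = emeasure M A + emeasure N A"
  unfolding add_measure_def
proof (rule emeasure_measure_of_sigma[OF sets.sigma_algebra_axioms])
  show "countably_additive (sets M) (\<lambda>A. emeasure M A + emeasure N A)"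
  proof (rule countably_additiveI)
    fix A :: "nat \<Rightarrow> 'a set"
    assume A: "range A \<subseteq> sets M" "disjoint_family A" "\<Union> (range A) \<in> sets M"
    then have "(\<Sum>i. emeasure M (A i) + emeasure N (A i)) = (\<Sum>i. emeasure M (A i)) + (\<Sum>i. emeasure N (A i))"
      by (intro suminf_add[symmetric] summableI)
    then show "(\<Sum>i. emeasure M (A i) + emeasure N (A i)) = emeasure M (\<Union> (range A)) + emeasure N (\<Union> (range A))"
      using A N by (simp add: suminf_emeasure)
  qed
qed (use assms in \<open>auto simp: positive_def\<close>)

text \<open>The maximal coupling: the common part of the two measures (read off a Hahn decomposition) is
  put on the diagonal, and the two excesses, of equal mass, are coupled independently.\<close>

lemma tv_dist_le:
  fixes \<mu> \<nu> :: "real measure"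
  assumes "prob_space \<mu>" "prob_space \<nu>" and s [measurable_cong]: "sets \<mu> = sets borel" "sets \<nu> = sets borel"
    and le: "\<And>A. A \<in> sets borel \<Longrightarrow> measure \<mu> A - measure \<nu> A \<le> \<epsilon>"
  shows "tv_dist \<mu> \<nu> \<le> \<epsilon>"
proof -
  interpret \<mu>: prob_space \<mu> by fact
  interpret \<nu>: prob_space \<nu> by fact
  have sp [simp]: "space \<mu> = UNIV" "space \<nu> = UNIV" using s by (auto dest: sets_eq_imp_space_eq)
  obtain Y where Y [measurable]: "Y \<in> sets borel"
    and Y1: "\<And>X. X \<in> sets borel \<Longrightarrow> X \<subseteq> Y \<Longrightarrow> emeasure \<nu> X \<le> emeasure \<mu> X"
    and Y2: "\<And>X. X \<in> sets borel \<Longrightarrow> X \<inter> Y = {} \<Longrightarrow> emeasure \<mu> X \<le> emeasure \<nu> X"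
    using finite_unsigned_Hahn_decomposition[OF \<mu>.finite_measure_axioms \<nu>.finite_measure_axioms] s by auto
  \<comment> \<open>The mass of each excess over the common part \<open>m\<close>. The hypothesis is
    applied only to the Hahn set \<open>Y\<close>, where it bounds \<open>p\<close> by
    \<epsilon>.\<close>
  define p where "p = measure \<mu> Y - measure \<nu> Y"
  define m where "m = add_measure (density \<nu> (indicator Y)) (density \<mu> (indicator (- Y)))"
  have sm [simp, measurable_cong]: "sets m = sets borel" by (simp add: m_def s)
  have spm [simp]: "space m = UNIV" by (simp add: m_def)
  have em: "emeasure m X = emeasure \<nu> (X \<inter> Y) + emeasure \<mu> (X - Y)" if [measurable]: "X \<in> sets borel" for X
  proof -
    have d: "emeasure (density N (indicator Z)) X = emeasure N (X \<inter> Z)"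
      if [measurable_cong]: "sets N = sets borel" and [measurable]: "Z \<in> sets borel" for N and Z :: "real set"
    proof -
      have "emeasure (density N (indicator Z)) X = (\<integral>\<^sup>+x. indicator (X \<inter> Z) x \<partial>N)"
        by (subst emeasure_density) (auto intro!: nn_integral_cong simp: that simp del: nn_integral_indicator split: split_indicator)
      also have "\<dots> = emeasure N (X \<inter> Z)" by (rule nn_integral_indicator) (simp add: that)
      finally show ?thesis .
    qed
    show ?thesis
      unfolding m_def by (subst emeasure_add_measure) (auto simp: s d Diff_eq)
  qed
  have split\<mu>: "emeasure \<mu> X = emeasure \<mu> (X \<inter> Y) + emeasure \<mu> (X - Y)" if [measurable]: "X \<in> sets borel" for X
    by (subst plus_emeasure) (auto simp: s intro!: arg_cong[where f = "emeasure \<mu>"])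
  have split\<nu>: "emeasure \<nu> X = emeasure \<nu> (X \<inter> Y) + emeasure \<nu> (X - Y)" if [measurable]: "X \<in> sets borel" for X
    by (subst plus_emeasure) (auto simp: s intro!: arg_cong[where f = "emeasure \<nu>"])
  have m\<mu>: "emeasure m X \<le> emeasure \<mu> X" if [measurable]: "X \<in> sets borel" for X
    unfolding em[OF that] split\<mu>[OF that] by (intro add_mono Y1) auto
  have m\<nu>: "emeasure m X \<le> emeasure \<nu> X" if [measurable]: "X \<in> sets borel" for X
    unfolding em[OF that] split\<nu>[OF that] by (intro add_mono Y2) auto
  interpret m: finite_measure m
  proof (rule finite_measureI)
    have "emeasure m UNIV \<le> emeasure \<mu> UNIV" by (rule m\<mu>) simp
    then show "emeasure m (space m) \<noteq> \<infinity>"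
      using \<mu>.emeasure_space_1 by (auto simp: top_unique)
  qed
  define r1 where "r1 = diff_measure \<mu> m"
  define r2 where "r2 = diff_measure \<nu> m"
  have sr [simp, measurable_cong]: "sets r1 = sets borel" "sets r2 = sets borel"
    by (auto simp: r1_def r2_def s)
  have spr [simp]: "space r1 = UNIV" "space r2 = UNIV" by (auto simp: r1_def r2_def)
  have r1: "emeasure r1 X = emeasure \<mu> X - emeasure m X" if "X \<in> sets borel" for X
    unfolding r1_def
    by (rule emeasure_diff_measure) (use that in \<open>auto simp: s \<mu>.finite_measure_axioms m.finite_measure_axioms m\<mu>\<close>)
  have r2: "emeasure r2 X = emeasure \<nu> X - emeasure m X" if "X \<in> sets borel" for X
    unfolding r2_def
    by (rule emeasure_diff_measure) (use that in \<open>auto simp: s \<nu>.finite_measure_axioms m.finite_measure_axioms m\<nu>\<close>)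
  have m1: "measure m UNIV = 1 - p"
  proof -
    have "measure m UNIV = measure \<nu> Y + measure \<mu> (UNIV - Y)"
      using em[of UNIV]
      by (simp add: m.emeasure_eq_measure \<mu>.emeasure_eq_measure \<nu>.emeasure_eq_measure
        flip: ennreal_plus)
    also have "measure \<mu> (UNIV - Y) = 1 - measure \<mu> Y"
      using \<mu>.prob_compl[of Y] by (simp add: s)
    finally show ?thesis by (simp add: p_def)
  qed
  have p: "0 \<le> p" "p \<le> 1"
  proof -
    have "measure \<nu> Y \<le> measure \<mu> Y"
      using Y1[of Y] by (simp add: \<nu>.emeasure_eq_measure \<mu>.emeasure_eq_measure)
    then show "0 \<le> p" by (simp add: p_def)
    show "p \<le> 1" using m1 measure_nonneg[of m UNIV] by simp
  qed
  have mass: "emeasure r1 UNIV = ennreal p" "emeasure r2 UNIV = ennreal p"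
    using p m1 \<mu>.emeasure_space_1 \<nu>.emeasure_space_1
    by (simp_all add: r1 r2 m.emeasure_eq_measure ennreal_minus flip: ennreal_1)
  interpret r1: finite_measure r1 by (rule finite_measureI) (simp add: mass)
  interpret r2: finite_measure r2 by (rule finite_measureI) (simp add: mass)
  \<comment> \<open>Both excesses have mass \<open>p\<close>, so \<open>1 / p\<close> restores the
    marginals. If \<open>p = 0\<close>, then \<open>1 / p = 0\<close> and the excesses are null, so
    the formula still holds.\<close>
  define \<gamma> where "\<gamma> = add_measure (distr m (borel \<Otimes>\<^sub>M borel) (\<lambda>x. (x, x)))
    (scale_measure (ennreal (1 / p)) (r1 \<Otimes>\<^sub>M r2))"
  have spair: "sets (r1 \<Otimes>\<^sub>M r2) = sets (borel \<Otimes>\<^sub>M borel)" by (intro sets_pair_measure_cong) auto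
  have s\<gamma> [simp, measurable_cong]: "sets \<gamma> = sets (borel \<Otimes>\<^sub>M borel)" by (simp add: \<gamma>_def)
  have e\<gamma>: "emeasure \<gamma> X = emeasure m ((\<lambda>x. (x, x)) -` X) + ennreal (1 / p) * emeasure (r1 \<Otimes>\<^sub>M r2) X"
    if [measurable]: "X \<in> sets (borel \<Otimes>\<^sub>M borel)" for X
    unfolding \<gamma>_def by (subst emeasure_add_measure) (auto simp: spair emeasure_distr)
  have scale: "ennreal (1 / p) * (a * ennreal p) = a" if "p = 0 \<Longrightarrow> a = 0" for a
    using that p by (cases "p = 0") (auto simp: mult.left_commute[of _ a] ennreal_mult'[symmetric])
  have null1: "emeasure r1 X = 0" if "p = 0" "X \<in> sets borel" for X
    using emeasure_mono[of X UNIV r1] that mass by simp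
  have null2: "emeasure r2 X = 0" if "p = 0" "X \<in> sets borel" for X
    using emeasure_mono[of X UNIV r2] that mass by simp
  have fst: "distr \<gamma> borel fst = \<mu>"
  proof (rule measure_eqI)
    fix A assume "A \<in> sets (distr \<gamma> borel fst)"
    then have A [measurable]: "A \<in> sets borel" by simp
    have "fst -` A \<inter> space \<gamma> = A \<times> UNIV"
      using sets_eq_imp_space_eq[OF s\<gamma>] by (auto simp: space_pair_measure)
    then have "emeasure (distr \<gamma> borel fst) A = emeasure \<gamma> (A \<times> UNIV)"
      by (subst emeasure_distr) auto
    also have "\<dots> = emeasure m A + ennreal (1 / p) * (emeasure r1 A * ennreal p)"
      by (subst e\<gamma>) (auto simp: r2.emeasure_pair_measure_Times mass intro!: arg_cong[where f = "emeasure m"])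
    also have "\<dots> = emeasure \<mu> A"
      using m\<mu>[OF A] null1[OF _ A]
      by (subst scale) (auto simp: r1[OF A] intro!: add_diff_inverse_ennreal)
    finally show "emeasure (distr \<gamma> borel fst) A = emeasure \<mu> A" .
  qed (simp add: s)
  have snd: "distr \<gamma> borel snd = \<nu>"
  proof (rule measure_eqI)
    fix A assume "A \<in> sets (distr \<gamma> borel snd)"
    then have A [measurable]: "A \<in> sets borel" by simp
    have "snd -` A \<inter> space \<gamma> = UNIV \<times> A"
      using sets_eq_imp_space_eq[OF s\<gamma>] by (auto simp: space_pair_measure)
    then have "emeasure (distr \<gamma> borel snd) A = emeasure \<gamma> (UNIV \<times> A)"
      by (subst emeasure_distr) auto
    also have "\<dots> = emeasure m A + ennreal (1 / p) * (emeasure r2 A * ennreal p)"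
      by (subst e\<gamma>) (auto simp: r2.emeasure_pair_measure_Times mass mult.commute intro!: arg_cong[where f = "emeasure m"])
    also have "\<dots> = emeasure \<nu> A"
      using m\<nu>[OF A] null2[OF _ A]
      by (subst scale) (auto simp: r2[OF A] intro!: add_diff_inverse_ennreal)
    finally show "emeasure (distr \<gamma> borel snd) A = emeasure \<nu> A" .
  qed (simp add: s)
  have "prob_space \<gamma>"
  proof (rule prob_spaceI)
    have "emeasure \<gamma> (space \<gamma>) = emeasure (distr \<gamma> borel fst) UNIV"
      by (subst emeasure_distr) auto
    then show "emeasure \<gamma> (space \<gamma>) = 1" using \<mu>.emeasure_space_1 by (simp add: fst)
  qed
  then interpret \<gamma>: prob_space \<gamma> .
  have \<gamma>: "\<gamma> \<in> couplings \<mu> \<nu>"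
    using fst snd \<open>prob_space \<gamma>\<close> by (simp add: couplings_def)
  let ?D = "{(x, y). x \<noteq> (y :: real)}"
  have D: "?D \<in> sets (borel \<Otimes>\<^sub>M borel)"
  proof -
    have "{p \<in> space (borel \<Otimes>\<^sub>M borel). fst p \<noteq> (snd p :: real)} \<in> sets (borel \<Otimes>\<^sub>M borel)"
      by measurable
    then show ?thesis by (simp add: space_pair_measure split_beta')
  qed
  have "emeasure \<gamma> ?D = ennreal (1 / p) * emeasure (r1 \<Otimes>\<^sub>M r2) ?D"
    using D by (subst e\<gamma>) auto
  also have "\<dots> \<le> ennreal (1 / p) * emeasure (r1 \<Otimes>\<^sub>M r2) (UNIV \<times> UNIV)"
    using sets.top[of "borel \<Otimes>\<^sub>M (borel :: real measure) :: (real \<times> real) measure"]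
    by (intro mult_left_mono emeasure_mono) (auto simp: spair space_pair_measure)
  also have "\<dots> = ennreal p"
    using scale[of "ennreal p"] by (subst r2.emeasure_pair_measure_Times) (auto simp: mass)
  finally have "measure \<gamma> ?D \<le> p" using p by (simp add: \<gamma>.emeasure_eq_measure)
  moreover have "(\<integral>q. indicator ?D q \<partial>\<gamma>) = measure \<gamma> ?D" using D by simp
  moreover have "tv_dist \<mu> \<nu> \<le> (\<integral>q. indicator ?D q \<partial>\<gamma>)"
    unfolding tv_dist_def
    by (rule cINF_lower[OF _ \<gamma>]) (auto intro!: bdd_belowI2[where m = 0] integral_nonneg_AE)
  ultimately show ?thesis using le[OF Y] by (simp add: p_def)
qed

subsection \<open>Mixing\<close>

lemma tcp_op_affine:
  assumes f [measurable]: "f \<in> borel_measurable borel" and bd: "\<And>x. \<bar>f x\<bar> \<le> B"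
  shows "tcp_op t (\<lambda>a. c + k * f a) x = c + k * tcp_op t f x"
proof -
  have [measurable]: "(\<lambda>\<omega>. tcp_process x \<omega> t) \<in> borel_measurable tcp_clocks"
    using measurable_compose[OF _ measurable_tcp_process_joint, of "\<lambda>\<omega>. (x, t, \<omega>)" tcp_clocks] by simp
  have "integrable tcp_clocks (\<lambda>\<omega>. f (tcp_process x \<omega> t))"
    by (rule clocks.integrable_const_bound[where B = B]) (auto simp: bd)
  then show ?thesis
    unfolding tcp_op_def by (simp add: clocks.prob_space[simplified])
qed

text \<open>The functions are compared only on the half-line; \<open>tcp_op_near\<close>, centered
  at the middle of the range of \<open>g - f\<close>, transfers the sign from there.\<close>

lemma tcp_op_mono:
  assumes f: "f \<in> borel_measurable borel" "\<And>x. \<bar>f x\<bar> \<le> B"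
    and g: "g \<in> borel_measurable borel" "\<And>x. \<bar>g x\<bar> \<le> B'"
    and x: "0 \<le> x" "0 \<le> t" and le: "\<And>a. 0 \<le> a \<Longrightarrow> f a \<le> g a"
  shows "tcp_op t f x \<le> tcp_op t g x"
proof -
  have bd: "\<bar>g a - f a\<bar> \<le> B + B'" for a using f(2)[of a] g(2)[of a] by linarith
  have "\<bar>tcp_op t (\<lambda>a. g a - f a) x - (B + B') / 2\<bar> \<le> (B + B') / 2"
  proof (rule tcp_op_near[OF _ bd x])
    show "\<bar>g a - f a - (B + B') / 2\<bar> \<le> (B + B') / 2" if "0 \<le> a" for a
    proof -
      have "0 \<le> g a - f a" "g a - f a \<le> B + B'" using le[OF that] bd[of a] by auto
      then show ?thesis by (auto simp: abs_if field_simps)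
    qed
  qed (use f g in measurable)
  then have "0 \<le> tcp_op t (\<lambda>a. g a - f a) x" by linarith
  then show ?thesis using tcp_op_diff[OF g(1) f(1) g(2) f(2)] by simp
qed

lemma tcp_op_abs_le:
  assumes f: "f \<in> borel_measurable borel" "\<And>x. \<bar>f x\<bar> \<le> B"
    and g: "g \<in> borel_measurable borel" "\<And>x. \<bar>g x\<bar> \<le> B'"
    and x: "0 \<le> x" "0 \<le> t" and le: "\<And>a. 0 \<le> a \<Longrightarrow> \<bar>f a\<bar> \<le> c + k * g a"
  shows "\<bar>tcp_op t f x\<bar> \<le> c + k * tcp_op t g x"
proof -
  have bd: "\<bar>c + k * g a\<bar> \<le> \<bar>c\<bar> + \<bar>k\<bar> * B'" for a
    using mult_left_mono[OF g(2)[of a], of "\<bar>k\<bar>"]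
    by (intro order_trans[OF abs_triangle_ineq] add_mono) (auto simp: abs_mult)
  have m: "(\<lambda>a. c + k * g a) \<in> borel_measurable borel" using g(1) by measurable
  have m': "(\<lambda>a. - c + (- k) * g a) \<in> borel_measurable borel" using g(1) by measurable
  have bd': "\<bar>- c + (- k) * g a\<bar> \<le> \<bar>c\<bar> + \<bar>k\<bar> * B'" for a
    using bd[of a] by (simp add: abs_le_iff)
  have "tcp_op t f x \<le> tcp_op t (\<lambda>a. c + k * g a) x"
    using le by (intro tcp_op_mono[OF f m bd x]) (fastforce simp: abs_le_iff)
  moreover have "tcp_op t (\<lambda>a. - c + (- k) * g a) x \<le> tcp_op t f x"
    using le by (intro tcp_op_mono[OF m' bd' f x]) (fastforce simp: abs_le_iff)
  ultimately show ?thesis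
    unfolding tcp_op_affine[OF g] by (simp add: abs_le_iff)
qed

text \<open>Turns a Lipschitz bound on a \<open>[0, 1]\<close>-valued function into a square-root
  one, the class on which \<open>tcp_op_contract\<close> acts.\<close>

lemma sqrt_ge_self: "0 \<le> a \<Longrightarrow> a \<le> 1 \<Longrightarrow> a \<le> b \<Longrightarrow> a \<le> sqrt b" for a b :: real
  by (rule real_le_rsqrt) (use mult_left_mono[of a 1 a] in \<open>simp add: power2_eq_square\<close>)

text \<open>In forward time: one unit to come down from infinity, \<open>s\<close> to contract,
  \<tau> to smooth. The witness for \<open>c\<close> is \<open>tcp_op s g 0\<close>, where
  \<open>g\<close> is the smoothed and clipped \<open>f\<close>.\<close>

lemma tcp_op_mixing:
  assumes f [measurable]: "f \<in> borel_measurable borel" and f01: "\<And>x. 0 \<le> f x" "\<And>x. f x \<le> 1"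
    and s: "0 < s" and \<tau>: "1 \<le> \<tau>" and R: "1 \<le> R"
  shows "\<exists>c. \<forall>x\<ge>0. \<bar>tcp_op (1 + s + \<tau>) f x - c\<bar>
    \<le> 8 * sqrt (8 * (1 + R + \<tau>)) * exp (- (3 / 20 * s)) + exp (- (\<tau>\<^sup>2 / 2)) + 3 / R"
proof -
  define clip where "clip z = max 0 (min z R)" for z :: real
  have clip [measurable]: "clip \<in> borel_measurable borel" unfolding clip_def by measurable
  have clipR: "0 \<le> clip z" "clip z \<le> R" "\<bar>clip z\<bar> \<le> R" for z using R by (auto simp: clip_def)
  have clip_mean: "tcp_op 1 clip x \<le> 3" if "0 \<le> x" for x
    using tcp_op_truncated_mean[OF that, of R] R by (simp add: clip_def[abs_def])
  define H where "H = sqrt (8 * (1 + R + \<tau>))"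
  have H: "0 \<le> H" "0 < H" using R \<tau> by (simp_all add: H_def)
  define \<kappa> where "\<kappa> = 2 * H * exp (- (3 / 20 * s))"
  have \<kappa>: "0 < \<kappa>" using H by (simp add: \<kappa>_def)
  have fb: "\<bar>f z\<bar> \<le> 1" for z using f01[of z] by simp
  have Pf: "tcp_op \<tau> f \<in> borel_measurable borel" "\<bar>tcp_op \<tau> f z\<bar> \<le> 1" for z
    using tcp_op_bound[of f, OF fb] by auto
  have \<tau>0: "0 \<le> \<tau>" using \<tau> by simp
  \<comment> \<open>Clipping the argument makes the Lipschitz constant of \<open>jump_part\<close>,
    which grows with the position, at most \<open>8 * (1 + R + \<tau>)\<close> everywhere.\<close>
  define g where "g z = jump_part \<tau> f (clip z)" for z
  have split: "jump_part \<tau> f z = tcp_op \<tau> f z - exp (- hazard z \<tau>) * f (z + \<tau>)" if "0 \<le> z" for z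
    using tcp_op_renewal[OF f fb that \<tau>0] by (simp add: jump_part_def)
  have g [measurable]: "g \<in> borel_measurable borel"
    unfolding g_def split[OF clipR(1)] hazard_def by measurable
  have g01: "0 \<le> g z" "g z \<le> 1" for z
    unfolding g_def by (intro jump_part_01 f f01 clipR \<tau>0)+
  have gb: "\<bar>g z\<bar> \<le> 1" for z using g01[of z] by simp
  have ghoelder: "\<bar>g a - g b\<bar> \<le> H * sqrt (b - a)" if "0 \<le> a" "a \<le> b" for a b
  proof -
    have ab: "clip a \<le> clip b" "clip b - clip a \<le> b - a" using that R by (auto simp: clip_def)
    have "\<bar>g a - g b\<bar> \<le> 8 * (1 + clip b + \<tau>) * (clip b - clip a)"
      unfolding g_def by (rule jump_part_lipschitz[OF f f01 clipR(1) ab(1) \<tau>])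
    also have "\<dots> \<le> 8 * (1 + R + \<tau>) * (b - a)"
      using ab clipR(1)[of a] clipR(1)[of b] clipR(2)[of b] R \<tau> by (intro mult_mono) auto
    finally have "\<bar>g a - g b\<bar> \<le> sqrt (8 * (1 + R + \<tau>) * (b - a))"
      using g01[of a] g01[of b] by (intro sqrt_ge_self) auto
    then show ?thesis by (simp add: H_def real_sqrt_mult)
  qed
  define G where "G = tcp_op s g"
  have G [measurable]: "G \<in> borel_measurable borel" unfolding G_def by measurable
  have Gb: "\<bar>G z\<bar> \<le> 1" for z unfolding G_def by (rule tcp_op_bound[of g, OF gb])
  have G0: "\<bar>G a - G 0\<bar> \<le> \<kappa> * sqrt a" if "0 \<le> a" for a
    using tcp_op_contract[OF g gb H(1) ghoelder order_refl that s] by (simp add: G_def \<kappa>_def abs_minus_commute)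
  have near0: "\<bar>tcp_op 1 G x - G 0\<bar> \<le> 4 * \<kappa>" if x: "0 \<le> x" for x
  proof -
    \<comment> \<open>By \<open>sqrt a \<le> 1 + a\<close> and mean at most \<open>3\<close> the
      expected error is at most \<open>4 * \<kappa>\<close>. The mean bound covers truncations only;
      beyond this \<open>B\<close> the truncated majorant already exceeds the trivial bound
      \<open>2\<close>.\<close>
    define B where "B = 2 / \<kappa>"
    define k where "k z = max 0 (min z B)" for z :: real
    have B: "0 \<le> B" "\<kappa> * B = 2" using \<kappa> by (auto simp: B_def)
    have k: "k \<in> borel_measurable borel" "\<bar>k z\<bar> \<le> B" for z
      using B by (auto simp: k_def[abs_def])
    have "\<bar>tcp_op 1 (\<lambda>a. G a - G 0) x\<bar> \<le> \<kappa> + \<kappa> * tcp_op 1 k x"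
    proof (rule tcp_op_abs_le)
      show bd: "\<bar>G a - G 0\<bar> \<le> 2" for a using Gb[of a] Gb[of 0] by linarith
      show "\<bar>G a - G 0\<bar> \<le> \<kappa> + \<kappa> * k a" if a: "0 \<le> a" for a
      proof (cases "a \<le> B")
        case True
        have "sqrt a \<le> 1 + a" using a by (intro real_le_lsqrt) (auto simp: power2_eq_square algebra_simps)
        then have "\<kappa> * sqrt a \<le> \<kappa> * (1 + a)" using \<kappa> by (intro mult_left_mono) auto
        also have "\<dots> = \<kappa> + \<kappa> * k a" using True a by (simp add: k_def distrib_left)
        finally show ?thesis using G0[OF a] by linarith
      next
        case False
        then have "k a = B" using B by (simp add: k_def)
        then show ?thesis using B bd[of a] \<kappa> by simp
      qed
    qed (use x k G in auto)
    also have "\<dots> \<le> \<kappa> + \<kappa> * 3"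
      using tcp_op_truncated_mean[OF x B(1)] \<kappa>
      by (intro add_left_mono mult_left_mono) (auto simp: k_def[abs_def])
    finally have "\<bar>tcp_op 1 (\<lambda>a. G a - G 0) x\<bar> \<le> 4 * \<kappa>" by simp
    moreover have "tcp_op 1 (\<lambda>a. G a - G 0) x = tcp_op 1 G x - G 0"
      using tcp_op_affine[OF G Gb, of 1 "- G 0" 1 x] by simp
    ultimately show ?thesis by simp
  qed
  have near1: "\<bar>tcp_op (1 + s) (tcp_op \<tau> f) x - tcp_op (1 + s) g x\<bar> \<le> exp (- (\<tau>\<^sup>2 / 2)) + 3 / R"
    if x: "0 \<le> x" for x
  proof -
    have "\<bar>tcp_op (1 + s) (\<lambda>a. tcp_op \<tau> f a - g a) x\<bar> \<le> exp (- (\<tau>\<^sup>2 / 2)) + 1 / R * tcp_op (1 + s) clip x"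
    proof (rule tcp_op_abs_le)
      show "\<bar>tcp_op \<tau> f a - g a\<bar> \<le> 2" for a using Pf(2)[of a] gb[of a] by linarith
      \<comment> \<open>Up to \<open>R\<close> the error is the no-jump term; above \<open>R\<close>
        it is at most \<open>1 = clip a / R\<close>, which amounts to Markov's inequality.\<close>
      show "\<bar>tcp_op \<tau> f a - g a\<bar> \<le> exp (- (\<tau>\<^sup>2 / 2)) + 1 / R * clip a" if a: "0 \<le> a" for a
      proof (cases "a \<le> R")
        case True
        then have "clip a = a" using a by (simp add: clip_def)
        then have "\<bar>tcp_op \<tau> f a - g a\<bar> = exp (- hazard a \<tau>) * f (a + \<tau>)"
          using f01[of "a + \<tau>"] by (simp add: g_def split[OF a])
        also have "\<dots> \<le> exp (- (\<tau>\<^sup>2 / 2)) * 1"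
          using a \<tau> f01 by (intro mult_mono) (auto simp: hazard_def)
        finally show ?thesis using clipR(1)[of a] R by (smt (verit) divide_nonneg_nonneg mult_nonneg_nonneg)
      next
        case False
        then have "clip a = R" using R by (simp add: clip_def)
        moreover have "\<bar>tcp_op \<tau> f a - g a\<bar> \<le> 1"
          using tcp_op_01[OF f f01 \<tau>0 a] g01[of a] by linarith
        ultimately show ?thesis
          using R exp_ge_zero[of "- (\<tau>\<^sup>2 / 2)"] by (simp del: exp_ge_zero)
      qed
    qed (use x s clipR(3) in auto)
    \<comment> \<open>Here the unit of time is split off at the end, since
      \<open>tcp_op 1 clip\<close> is at most \<open>3\<close> at every starting point.\<close>
    also have "tcp_op (1 + s) clip x = tcp_op s (tcp_op 1 clip) x"
      using tcp_op_semigroup[OF clip clipR(3) x, of s 1] s by (simp add: add.commute)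
    also have "\<dots> \<le> 3"
    proof -
      have cb: "\<bar>tcp_op 1 clip a\<bar> \<le> R" for a by (rule tcp_op_bound) (rule clipR)
      have "tcp_op s (tcp_op 1 clip) x \<le> tcp_op s (\<lambda>_. 3) x"
        by (rule tcp_op_mono[where B' = 3, OF _ cb]) (use x s clip_mean in auto)
      then show ?thesis by (simp add: tcp_op_def clocks.prob_space[simplified])
    qed
    finally have "\<bar>tcp_op (1 + s) (\<lambda>a. tcp_op \<tau> f a - g a) x\<bar> \<le> exp (- (\<tau>\<^sup>2 / 2)) + 1 / R * 3"
      using R by (simp add: divide_right_mono)
    then show ?thesis using tcp_op_diff[OF Pf(1) g Pf(2) gb] by simp
  qed
  have "\<bar>tcp_op (1 + s + \<tau>) f x - G 0\<bar> \<le> 4 * \<kappa> + (exp (- (\<tau>\<^sup>2 / 2)) + 3 / R)" if x: "0 \<le> x" for x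
  proof -
    have "tcp_op (1 + s + \<tau>) f x = tcp_op (1 + s) (tcp_op \<tau> f) x"
      by (rule tcp_op_semigroup[OF f fb]) (use x s \<tau> in auto)
    moreover have "tcp_op (1 + s) g x = tcp_op 1 G x"
      unfolding G_def by (rule tcp_op_semigroup[OF g gb]) (use x s in auto)
    ultimately show ?thesis using near0[OF x] near1[OF x] by linarith
  qed
  then show ?thesis
    by (intro exI[of _ "G 0"]) (simp add: \<kappa>_def H_def algebra_simps)
qed

section \<open>Choice of the parameters and passage to total variation\<close>

text \<open>Contraction over nine tenths of the time gives
  \<open>3 / 20 * 9 / 10 = 27 / 200\<close>. The factor \<open>sqrt R\<close> costs
  \<open>1 / 24\<close> and the polynomial factor in \<tau> is given \<open>1 / 100\<close>; what
  remains is exactly \<open>1 / 12\<close>, the rate of \<open>3 / R\<close>.\<close>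

lemma mixing_rate_bound:
  assumes t: "10 \<le> t"
  defines "\<tau> \<equiv> t / 10" and "R \<equiv> exp (t / 12)"
  defines "s \<equiv> t - 1 - \<tau>"
  shows "8 * sqrt (8 * (1 + R + \<tau>)) * exp (- (3 / 20 * s)) + exp (- (\<tau>\<^sup>2 / 2)) + 3 / R
    \<le> 600 * exp (- (t / 12))"
proof -
  have R: "1 \<le> R" using t by (simp add: R_def)
  have \<tau>: "1 \<le> \<tau>" using t by (simp add: \<tau>_def)
  have "sqrt (8 * (1 + R + \<tau>)) \<le> sqrt ((3 * (exp (t / 24) * (2 + \<tau>)))\<^sup>2)"
  proof (rule real_sqrt_le_mono)
    have RR: "R = (exp (t / 24))\<^sup>2" by (simp add: R_def flip: exp_of_nat_mult)
    have "1 * \<tau> \<le> R * \<tau>" using R \<tau> by (intro mult_right_mono) auto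
    then have "8 * (1 + R + \<tau>) \<le> 8 * (R * (2 + \<tau>))"
      using R by (simp add: distrib_left)
    also have "\<dots> \<le> 9 * (R * (2 + \<tau>)\<^sup>2)"
      using R \<tau> self_le_power[of "2 + \<tau>" 2] by (intro mult_mono) auto
    finally show "8 * (1 + R + \<tau>) \<le> (3 * (exp (t / 24) * (2 + \<tau>)))\<^sup>2"
      by (simp add: RR power_mult_distrib)
  qed
  also have "\<dots> = 3 * (exp (t / 24) * (2 + \<tau>))"
    using \<tau> by (subst real_sqrt_abs) simp
  also have "\<dots> \<le> 3 * (exp (t / 24) * (12 * exp (t / 100)))"
  proof -
    have "2 + \<tau> \<le> 12 * exp (t / 100)"
      using exp_ge_add_one_self[of "t / 100"] t unfolding \<tau>_def by linarith
    then show ?thesis by simp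
  qed
  finally have "8 * sqrt (8 * (1 + R + \<tau>)) * exp (- (3 / 20 * s))
      \<le> 8 * (3 * (exp (t / 24) * (12 * exp (t / 100)))) * exp (- (3 / 20 * s))"
    by (intro mult_right_mono mult_left_mono) auto
  also have "\<dots> = 288 * (exp (t / 24) * exp (t / 100) * exp (- (3 / 20 * s)))" by simp
  also have "exp (t / 24) * exp (t / 100) * exp (- (3 / 20 * s)) = exp (3 / 20) * exp (- (t / 12))"
    unfolding exp_add[symmetric] s_def \<tau>_def by (intro arg_cong[where f = exp]) (simp add: field_simps)
  also have "288 * (exp (3 / 20) * exp (- (t / 12))) \<le> 288 * (2 * exp (- (t / 12)))"
  proof -
    have "exp (3 / 20) \<le> exp (1 / 2 :: real)" by simp
    then have "exp (3 / 20) \<le> (2 :: real)" using exp_half_le2 by linarith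
    then show ?thesis by simp
  qed
  finally have 1: "8 * sqrt (8 * (1 + R + \<tau>)) * exp (- (3 / 20 * s)) \<le> 576 * exp (- (t / 12))" by simp
  \<comment> \<open>\<open>t / 12\<close> is \<open>5 / 6 * \<tau>\<close>, so completing the square
    at \<open>5 / 6\<close> leaves \<open>25 / 72\<close>, below \<open>1 / 2\<close>.\<close>
  have "- (\<tau>\<^sup>2 / 2) \<le> 1 / 2 + - (t / 12)"
    using zero_le_power2[of "\<tau> - 5 / 6"] unfolding \<tau>_def power2_eq_square by (simp add: field_simps)
  then have "exp (- (\<tau>\<^sup>2 / 2)) \<le> exp (1 / 2 + - (t / 12))" by simp
  also have "exp (1 / 2 + - (t / 12)) = exp (1 / 2) * exp (- (t / 12))" by (rule exp_add)
  also have "exp (1 / 2) * exp (- (t / 12)) \<le> 2 * exp (- (t / 12))"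
    by (rule mult_right_mono[OF exp_half_le2 exp_ge_zero])
  finally have 2: "exp (- (\<tau>\<^sup>2 / 2)) \<le> 2 * exp (- (t / 12))" .
  have 3: "3 / R \<le> 3 * exp (- (t / 12))" by (simp only: R_def exp_minus) (simp only: divide_inverse order_refl)
  show ?thesis
    by (rule order_trans[OF add_mono[OF add_mono[OF 1 2] 3]]) simp
qed

lemma measure_tcp_law:
  assumes \<nu>: "prob_on_nonneg \<nu>" and A [measurable]: "A \<in> sets borel"
  shows "measure (tcp_law \<nu> t) A = (\<integral>x. tcp_op t (indicator A) x \<partial>\<nu>)"
proof -
  interpret N: prob_space \<nu> using \<nu> by (simp add: prob_on_nonneg_def)
  interpret pair_prob_space \<nu> tcp_clocks ..
  have [measurable_cong]: "sets \<nu> = sets borel" using \<nu> by (simp add: prob_on_nonneg_def)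
  have "measure (tcp_law \<nu> t) A = (\<integral>x. indicator A x \<partial>tcp_law \<nu> t)"
    by (simp add: tcp_law_def)
  also have "\<dots> = (\<integral>p. indicator A (case p of (x, \<omega>) \<Rightarrow> tcp_process x \<omega> t) \<partial>(\<nu> \<Otimes>\<^sub>M tcp_clocks))"
    unfolding tcp_law_def by (rule integral_distr) measurable
  also have "\<dots> = (\<integral>x. tcp_op t (indicator A) x \<partial>\<nu>)"
    unfolding tcp_op_def
    by (subst integral_fst'[symmetric]) (auto intro!: P.integrable_const_bound[where B = 1] simp: split_beta')
  finally show ?thesis .
qed

text \<open>\<open>1 / 8\<close> is tailored to the rate obtained:
  \<open>2 / 3 * 1 / 8 = 1 / 12\<close>.\<close>

lemma tcp_lambda_le: "tcp_lambda \<le> 1 / 8"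
proof -
  have s2: "1414 / 1000 \<le> sqrt (2 :: real)" "sqrt 2 \<le> (1415 / 1000 :: real)"
    by (rule real_le_rsqrt, simp add: power2_eq_square, rule real_le_lsqrt, auto simp: power2_eq_square)
  have s3: "1732 / 1000 \<le> sqrt (3 :: real)" by (rule real_le_rsqrt) (simp add: power2_eq_square)
  have "1414 / 1000 * (3 + 1732 / 1000) \<le> sqrt 2 * (3 + sqrt 3)"
    using s2 s3 by (intro mult_mono) auto
  then have "(912 / 1000)\<^sup>2 \<le> tcp_M" unfolding tcp_M_def by (simp add: power2_eq_square)
  then have "912 / 1000 \<le> sqrt tcp_M" by (rule real_le_rsqrt)
  then have "tcp_lambda \<le> sqrt 2 * (88 / 1000)" unfolding tcp_lambda_def by (intro mult_left_mono) auto
  also have "\<dots> \<le> 1 / 8" using s2 by simp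
  finally show ?thesis .
qed

text \<open>For each \<open>A\<close> both laws are within \<open>600 * exp (- (t / 12))\<close> of
  the same constant, since the \<open>c\<close> of \<open>tcp_op_mixing\<close> does not depend on
  the starting point.\<close>

lemma tv_dist_tcp_law_le:
  assumes \<nu>: "prob_on_nonneg \<nu>" "prob_on_nonneg \<nu>'" and "0 \<le> t"
  shows "tv_dist (tcp_law \<nu> t) (tcp_law \<nu>' t) \<le> 1200 * exp (- (t / 12))"
proof (rule tv_dist_le)
  show "prob_space (tcp_law \<nu> t)" "prob_space (tcp_law \<nu>' t)"
    by (rule prob_space_tcp_law, fact)+
  then interpret L: prob_space "tcp_law \<nu> t" + L': prob_space "tcp_law \<nu>' t" .
  fix A :: "real set" assume A [measurable]: "A \<in> sets borel"
  show "measure (tcp_law \<nu> t) A - measure (tcp_law \<nu>' t) A \<le> 1200 * exp (- (t / 12))"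
  proof (cases "10 \<le> t")
    case True
    let ?\<epsilon> = "600 * exp (- (t / 12))"
    have "1 + (t - 1 - t / 10) + t / 10 = t" by simp
    then obtain c where c: "\<And>x. 0 \<le> x \<Longrightarrow> \<bar>tcp_op t (indicator A) x - c\<bar> \<le> ?\<epsilon>"
      using tcp_op_mixing[of "indicator A" "t - 1 - t / 10" "t / 10" "exp (t / 12)"]
        order_trans[OF _ mixing_rate_bound[OF True]] True by (fastforce simp: indicator_def)
    have near: "\<bar>measure (tcp_law \<mu> t) A - c\<bar> \<le> ?\<epsilon>" if \<mu>: "prob_on_nonneg \<mu>" for \<mu>
    proof -
      interpret M: prob_space \<mu> using \<mu> by (simp add: prob_on_nonneg_def)
      have [measurable_cong]: "sets \<mu> = sets borel" and nn: "AE x in \<mu>. 0 \<le> x"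
        using \<mu> by (auto simp: prob_on_nonneg_def)
      have i: "integrable \<mu> (tcp_op t (indicator A))"
        by (rule M.integrable_const_bound[where B = 1])
          (auto intro!: AE_I2 tcp_op_bound simp: indicator_def)
      have "(\<integral>x. tcp_op t (indicator A) x \<partial>\<mu>) \<le> c + ?\<epsilon>"
        by (rule M.integral_le_const[OF i]) (use nn in eventually_elim, use c in \<open>force simp: abs_le_iff\<close>)
      moreover have "c - ?\<epsilon> \<le> (\<integral>x. tcp_op t (indicator A) x \<partial>\<mu>)"
        by (rule M.integral_ge_const[OF i]) (use nn in eventually_elim, use c in \<open>force simp: abs_le_iff\<close>)
      ultimately show ?thesis unfolding measure_tcp_law[OF \<mu> A] by (simp add: abs_le_iff)
    qed
    show ?thesis using near[OF \<nu>(1)] near[OF \<nu>(2)] by linarith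
  next
    case False
    \<comment> \<open>For \<open>t < 10\<close> the right-hand side is at least \<open>400\<close>,
      so the trivial bound \<open>1\<close> suffices.\<close>
    have "exp (- 1 :: real) \<le> exp (- (t / 12))" using False by simp
    moreover have "1 / 3 \<le> exp (- 1 :: real)"
      using exp_le by (simp add: exp_minus field_simps)
    moreover have "measure (tcp_law \<nu> t) A \<le> 1" "0 \<le> measure (tcp_law \<nu>' t) A" by auto
    ultimately show ?thesis by linarith
  qed
qed (auto simp: tcp_law_def)

theorem theorem1p5:
  fixes lam t0 :: real
  assumes "lam < tcp_lambda" and "t0 > 0"
  shows "\<exists>C::real. \<forall>\<nu> \<nu>' t. prob_on_nonneg \<nu> \<longrightarrow> prob_on_nonneg \<nu>' \<longrightarrow> t \<ge> t0 \<longrightarrow>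
           tv_dist (tcp_law \<nu> t) (tcp_law \<nu>' t) \<le> C * exp (- (2 * lam / 3) * t)"
proof (intro exI[of _ 1200] allI impI)
  fix \<nu> \<nu>' :: "real measure" and t :: real
  assume \<nu>: "prob_on_nonneg \<nu>" "prob_on_nonneg \<nu>'" and t: "t0 \<le> t"
  have "2 * lam / 3 * t \<le> 1 / 12 * t"
    using assms t tcp_lambda_le by (intro mult_right_mono) auto
  then have "1200 * exp (- (t / 12)) \<le> 1200 * exp (- (2 * lam / 3) * t)" by simp
  with tv_dist_tcp_law_le[OF \<nu>, of t] assms t
  show "tv_dist (tcp_law \<nu> t) (tcp_law \<nu>' t) \<le> 1200 * exp (- (2 * lam / 3) * t)" by linarith
qed

end
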